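(* Let $P$ be a (classical) PRO and let $\mathcal{P}$ be its globularization, i.e. the data with object set $\mathbb{N}$, hom-collections $\mathcal{P}(n,m)=\coprod_{P(n,m)}\mathcal{T}(\mathbf{1})$, and composition, monoidal sum, identities and unit induced from those of $P$ as described in the context. Then $\mathcal{P}$ is a globular PRO.
   Context: **Collections.** A globular set is a family of sets $X_k$ ($k\ge 0$) with source and target maps $s,t:X_{k+1}\to X_k$ satisfying $ss=st$, $ts=tt$; $\mathbf{Glob}$ is the (presheaf) category of globular sets, $\mathbf{1}$ its terminal object (one cell in each dimension), $!_X:X\to\mathbf{1}$ the unique map. $(\mathcal{T},\mu,\eta)$ is the free strict $\omega$-category monad on $\mathbf{Glob}$ ($\mathcal{T}(X)$ is the underlying globular set of the free strict $\omega$-category on $X$). A collection is a globular set $X$ with a map $x:X\to\mathcal{T}(\mathbf{1})$ (its arity map); $\mathbf{Col}=\mathbf{Glob}/\mathcal{T}(\mathbf{1})$. The cartesian product $\times$ in $\mathbf{Col}$ is the fibre product over $\mathcal{T}(\mathbf{1})$; its unit is the terminal collection $\mathrm{id}:\mathcal{T}(\mathbf{1})\to\mathcal{T}(\mathbf{1})$, written $\mathcal{T}(\mathbf{1})$. The composition tensor product $X\square Y$ of $x:X\to\mathcal{T}(\mathbf{1})$ and $y:Y\to\mathcal{T}(\mathbf{1})$ has underlying globular set the pullback of $x$ and $\mathcal{T}(!_Y):\mathcal{T}(Y)\to\mathcal{T}(\mathbf{1})$, with arity map $X\square Y\to\mathcal{T}(Y)\xrightarrow{\mathcal{T}(y)}\mathcal{T}^2(\mathbf{1})\xrightarrow{\mu_{\mathbf{1}}}\mathcal{T}(\mathbf{1})$.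 This is a monoidal structure on $\mathbf{Col}$ with unit $I=(\eta_{\mathbf{1}}:\mathbf{1}\to\mathcal{T}(\mathbf{1}))$. The interchange map $\boxtimes:(A\times B)\square(C\times D)\to(A\square C)\times(B\square D)$ is the canonical map induced by the projections. **PRO.** A PRO $P$ is a strict monoidal category with object set (identified with) $\mathbb{N}$ whose monoidal product $+$ is addition on objects; $P(n,m)$ is its hom-set. **Globular PRO.** A globular PRO $\mathcal{P}$ is a strict monoidal category enriched over $\mathbf{Col}$ (enrichment with respect to $\square$; the monoidal structure uses $\times$) with object set $\mathbb{N}$ and monoidal product given by addition on objects and unit $0$. Explicitly: collections $\mathcal{P}(n,m)$; collection maps $\circ_{n,m,l}:\mathcal{P}(m,l)\square\mathcal{P}(n,m)\to\mathcal{P}(n,l)$ and $j_n:I\to\mathcal{P}(n,n)$ making $\mathcal{P}$ a category enriched over $(\mathbf{Col},\square,I)$ (associativity and unit laws); collection maps $+_{n,m,l,k}:\mathcal{P}(n,m)\times\mathcal{P}(l,k)\to\mathcal{P}(n+l,m+k)$ that are functorial, i.e. $\circ\,(+\square+)=+\,(\circ\times\circ)\,\boxtimes$ as maps $[\mathcal{P}(m,r)\times\mathcal{P}(k,s)]\square[\mathcal{P}(n,m)\times\mathcal{P}(l,k)]\to\mathcal{P}(n+l,r+s)$, and $+\,(j_n\times j_m)=j_{n+m}$ (using $I\times I\cong I$); and a unit enriched functor $O$ from the one-object $\mathbf{Col}$-category with hom-object $\mathcal{T}(\mathbf{1})$, sending the object to $0$, i.e. a collection map $O:\mathcal{T}(\mathbf{1})\to\mathcal{P}(0,0)$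 compatible with composition and identities; such that $+$ is strictly associative, and strictly unital with respect to $O$ (using the unitors of $\times$). **Globularization.** Given a PRO $P$, put $\mathcal{P}(n,m)=P(n,m)\cdot\mathcal{T}(\mathbf{1})=\coprod_{P(n,m)}\mathcal{T}(\mathbf{1})$ (coproduct in $\mathbf{Col}$ of copies of the terminal collection). Both $\square$ and $\times$ distribute over coproducts in each variable, so $\mathcal{P}(m,p)\square\mathcal{P}(n,m)\cong (P(m,p)\times P(n,m))\cdot(\mathcal{T}(\mathbf{1})\square\mathcal{T}(\mathbf{1}))$ and $\mathcal{P}(n,m)\times\mathcal{P}(l,k)\cong(P(n,m)\times P(l,k))\cdot(\mathcal{T}(\mathbf{1})\times\mathcal{T}(\mathbf{1}))$. Composition is $\circ^P_{n,m,p}\cdot\phi$, with $\circ^P$ composition in $P$ and $\phi:\mathcal{T}(\mathbf{1})\square\mathcal{T}(\mathbf{1})\to\mathcal{T}(\mathbf{1})$ the (unique) monoid multiplication on the terminal collection; the sum is $+^P_{n,m,l,k}\cdot\Phi$, with $+^P$ the monoidal product of $P$ on morphisms and $\Phi:\mathcal{T}(\mathbf{1})\times\mathcal{T}(\mathbf{1})\cong\mathcal{T}(\mathbf{1})$ the canonical isomorphism; $j_n$ is the composite of $\eta_{\mathbf{1}}:I\to\mathcal{T}(\mathbf{1})$ with the inclusion of the summand of $\mathcal{P}(n,n)$ indexed by the identity of $n$ in $P$; the unit $O:\mathcal{T}(\mathbf{1})\to\mathcal{P}(0,0)$ is the inclusion of the summand indexed by the identity of $0$. *)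

theory Defs
  imports Main
begin

section \<open>Globular sets\<close>

text \<open>A globular set is given by carrier sets; the maps \<open>gsrc X k\<close> and \<open>gtgt X k\<close> go from
  dimension \<open>k + 1\<close> to dimension \<open>k\<close> and, like all maps below, only matter on the carriers.\<close>

record 'a glob =
  cells :: "nat \<Rightarrow> 'a set"
  gsrc :: "nat \<Rightarrow> 'a \<Rightarrow> 'a"
  gtgt :: "nat \<Rightarrow> 'a \<Rightarrow> 'a"

definition globular_set :: "('a, 'z) glob_scheme \<Rightarrow> bool" where
  "globular_set X \<longleftrightarrow>
     (\<forall>k. \<forall>x\<in>cells X (Suc k). gsrc X k x \<in> cells X k \<and> gtgt X k x \<in> cells X k) \<and>
     (\<forall>k. \<forall>x\<in>cells X (Suc (Suc k)).
        gsrc X k (gsrc X (Suc k) x) = gsrc X k (gtgt X (Suc k) x) \<and>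
        gtgt X k (gsrc X (Suc k) x) = gtgt X k (gtgt X (Suc k) x))"

definition globular_map ::
  "('a, 'y) glob_scheme \<Rightarrow> ('b, 'z) glob_scheme \<Rightarrow> (nat \<Rightarrow> 'a \<Rightarrow> 'b) \<Rightarrow> bool" where
  "globular_map X Y f \<longleftrightarrow>
     (\<forall>k. \<forall>x\<in>cells X k. f k x \<in> cells Y k) \<and>
     (\<forall>k. \<forall>x\<in>cells X (Suc k).
        f k (gsrc X k x) = gsrc Y k (f (Suc k) x) \<and>
        f k (gtgt X k x) = gtgt Y k (f (Suc k) x))"

definition map_comp_glob ::
  "(nat \<Rightarrow> 'b \<Rightarrow> 'c) \<Rightarrow> (nat \<Rightarrow> 'a \<Rightarrow> 'b) \<Rightarrow> nat \<Rightarrow> 'a \<Rightarrow> 'c"  (infixr \<open>\<odot>\<close> 55) where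
  "f \<odot> g = (\<lambda>k x. f k (g k x))"

definition map_eq :: "('a, 'z) glob_scheme \<Rightarrow> (nat \<Rightarrow> 'a \<Rightarrow> 'b) \<Rightarrow> (nat \<Rightarrow> 'a \<Rightarrow> 'b) \<Rightarrow> bool" where
  "map_eq X f g \<longleftrightarrow> (\<forall>k. \<forall>x\<in>cells X k. f k x = g k x)"

definition id_map :: "nat \<Rightarrow> 'a \<Rightarrow> 'a" where
  "id_map k x = x"

definition one_glob :: "unit glob" where
  "one_glob = \<lparr>cells = (\<lambda>_. UNIV), gsrc = (\<lambda>_ x. x), gtgt = (\<lambda>_ x. x)\<rparr>"

definition bang :: "nat \<Rightarrow> 'a \<Rightarrow> unit" where
  "bang k x = ()"


section \<open>The free strict omega-category monad\<close>

text \<open>Cells of the free strict omega-category on \<open>X\<close> are formal composites of cells of \<open>X\<close>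
  modulo the strict omega-category axioms. \<open>Cmp k u v\<close> is the composite of \<open>u\<close> after \<open>v\<close>
  along their common \<open>k\<close>-dimensional boundary (the \<open>k\<close>-source of \<open>u\<close> and \<open>k\<close>-target of \<open>v\<close>),
  \<open>Idt u\<close> is the identity one dimension higher than \<open>u\<close>. The dimension of a term is not
  recorded in it but passed separately.\<close>

datatype 'a gterm = Gen 'a | Idt "'a gterm" | Cmp nat "'a gterm" "'a gterm"

text \<open>As for globular sets, \<open>tsrc X n\<close> and \<open>ttgt X n\<close> take terms of dimension \<open>n + 1\<close> to terms
  of dimension \<open>n\<close>.\<close>

primrec tsrc :: "('a, 'z) glob_scheme \<Rightarrow> nat \<Rightarrow> 'a gterm \<Rightarrow> 'a gterm" where
  "tsrc X n (Gen x) = Gen (gsrc X n x)"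
| "tsrc X n (Idt u) = u"
| "tsrc X n (Cmp k u v) = (if k = n then tsrc X n v else Cmp k (tsrc X n u) (tsrc X n v))"

primrec ttgt :: "('a, 'z) glob_scheme \<Rightarrow> nat \<Rightarrow> 'a gterm \<Rightarrow> 'a gterm" where
  "ttgt X n (Gen x) = Gen (gtgt X n x)"
| "ttgt X n (Idt u) = u"
| "ttgt X n (Cmp k u v) = (if k = n then ttgt X n u else Cmp k (ttgt X n u) (ttgt X n v))"

text \<open>\<open>iter_bd d k n\<close> iterates a family of maps \<open>d i\<close> from dimension \<open>i + 1\<close> to dimension \<open>i\<close>,
  going from dimension \<open>n\<close> down to dimension \<open>k \<le> n\<close>.\<close>

primrec iter_bd :: "(nat \<Rightarrow> 'a \<Rightarrow> 'a) \<Rightarrow> nat \<Rightarrow> nat \<Rightarrow> 'a \<Rightarrow> 'a" where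
  "iter_bd d k 0 x = x"
| "iter_bd d k (Suc n) x = (if n < k then x else iter_bd d k n (d n x))"

abbreviation tsrc_to :: "('a, 'z) glob_scheme \<Rightarrow> nat \<Rightarrow> nat \<Rightarrow> 'a gterm \<Rightarrow> 'a gterm" where
  "tsrc_to X \<equiv> iter_bd (tsrc X)"

abbreviation ttgt_to :: "('a, 'z) glob_scheme \<Rightarrow> nat \<Rightarrow> nat \<Rightarrow> 'a gterm \<Rightarrow> 'a gterm" where
  "ttgt_to X \<equiv> iter_bd (ttgt X)"

text \<open>The relation \<open>teq X n\<close> on terms of dimension \<open>n\<close> is a partial equivalence relation: it
  simultaneously singles out the well-formed terms (those with \<open>teq X n t t\<close>; composability is
  itself a condition up to provable equality) and identifies those that are equal in every strict
  omega-category.\<close>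

inductive teq :: "('a, 'z) glob_scheme \<Rightarrow> nat \<Rightarrow> 'a gterm \<Rightarrow> 'a gterm \<Rightarrow> bool"
  for X :: "('a, 'z) glob_scheme" where
  teq_gen: "x \<in> cells X n \<Longrightarrow> teq X n (Gen x) (Gen x)"
| teq_idt: "teq X n u u' \<Longrightarrow> teq X (Suc n) (Idt u) (Idt u')"
| teq_cmp: "k < n \<Longrightarrow> teq X n u u' \<Longrightarrow> teq X n v v' \<Longrightarrow>
    teq X k (tsrc_to X k n u) (ttgt_to X k n v) \<Longrightarrow>
    teq X n (Cmp k u v) (Cmp k u' v')"
| teq_sym: "teq X n u v \<Longrightarrow> teq X n v u"
| teq_trans: "teq X n u v \<Longrightarrow> teq X n v w \<Longrightarrow> teq X n u w"
| teq_assoc: "k < n \<Longrightarrow> teq X n u u \<Longrightarrow> teq X n v v \<Longrightarrow> teq X n w w \<Longrightarrow>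
    teq X k (tsrc_to X k n u) (ttgt_to X k n v) \<Longrightarrow>
    teq X k (tsrc_to X k n v) (ttgt_to X k n w) \<Longrightarrow>
    teq X n (Cmp k (Cmp k u v) w) (Cmp k u (Cmp k v w))"
| teq_unit_left: "k < n \<Longrightarrow> teq X n u u \<Longrightarrow>
    teq X n (Cmp k ((Idt ^^ (n - k)) (ttgt_to X k n u)) u) u"
| teq_unit_right: "k < n \<Longrightarrow> teq X n u u \<Longrightarrow>
    teq X n (Cmp k u ((Idt ^^ (n - k)) (tsrc_to X k n u))) u"
| teq_interchange: "j < k \<Longrightarrow> k < n \<Longrightarrow>
    teq X n u u \<Longrightarrow> teq X n v v \<Longrightarrow> teq X n u' u' \<Longrightarrow> teq X n v' v' \<Longrightarrow>
    teq X k (tsrc_to X k n u) (ttgt_to X k n v) \<Longrightarrow>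
    teq X k (tsrc_to X k n u') (ttgt_to X k n v') \<Longrightarrow>
    teq X j (tsrc_to X j n u) (ttgt_to X j n u') \<Longrightarrow>
    teq X j (tsrc_to X j n v) (ttgt_to X j n v') \<Longrightarrow>
    teq X n (Cmp j (Cmp k u v) (Cmp k u' v')) (Cmp k (Cmp j u u') (Cmp j v v'))"
| teq_idt_cmp: "k < n \<Longrightarrow> teq X n u u \<Longrightarrow> teq X n v v \<Longrightarrow>
    teq X k (tsrc_to X k n u) (ttgt_to X k n v) \<Longrightarrow>
    teq X (Suc n) (Idt (Cmp k u v)) (Cmp k (Idt u) (Idt v))"

definition tclass :: "('a, 'z) glob_scheme \<Rightarrow> nat \<Rightarrow> 'a gterm \<Rightarrow> 'a gterm set" where
  "tclass X n t = {u. teq X n t u}"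

definition free :: "('a, 'z) glob_scheme \<Rightarrow> 'a gterm set glob" where
  "free X =
     \<lparr>cells = (\<lambda>n. {tclass X n t | t. teq X n t t}),
      gsrc = (\<lambda>n c. \<Union>t\<in>c. tclass X n (tsrc X n t)),
      gtgt = (\<lambda>n c. \<Union>t\<in>c. tclass X n (ttgt X n t))\<rparr>"

primrec tmap :: "(nat \<Rightarrow> 'a \<Rightarrow> 'b) \<Rightarrow> 'a gterm \<Rightarrow> nat \<Rightarrow> 'b gterm" where
  "tmap f (Gen x) n = Gen (f n x)"
| "tmap f (Idt u) n = Idt (tmap f u (n - 1))"
| "tmap f (Cmp k u v) n = Cmp k (tmap f u n) (tmap f v n)"

text \<open>Substitution of representatives into a formal composite of classes of terms.\<close>

primrec tflat :: "'a gterm set gterm \<Rightarrow> 'a gterm" where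
  "tflat (Gen c) = (SOME t. t \<in> c)"
| "tflat (Idt u) = Idt (tflat u)"
| "tflat (Cmp k u v) = Cmp k (tflat u) (tflat v)"

text \<open>Action of the monad on a map \<open>f\<close> with codomain \<open>Y\<close>, the unit and the multiplication.\<close>

definition free_map ::
  "('b, 'z) glob_scheme \<Rightarrow> (nat \<Rightarrow> 'a \<Rightarrow> 'b) \<Rightarrow> nat \<Rightarrow> 'a gterm set \<Rightarrow> 'b gterm set" where
  "free_map Y f n c = (\<Union>t\<in>c. tclass Y n (tmap f t n))"

definition free_unit :: "('a, 'z) glob_scheme \<Rightarrow> nat \<Rightarrow> 'a \<Rightarrow> 'a gterm set" where
  "free_unit X n x = tclass X n (Gen x)"

definition free_mult ::
  "('a, 'z) glob_scheme \<Rightarrow> nat \<Rightarrow> 'a gterm set gterm set \<Rightarrow> 'a gterm set" where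
  "free_mult X n c = (\<Union>t\<in>c. tclass X n (tflat t))"


section \<open>Collections\<close>

type_synonym arity = "unit gterm set"

record 'a coll = "'a glob" +
  ar :: "nat \<Rightarrow> 'a \<Rightarrow> arity"

definition collection :: "'a coll \<Rightarrow> bool" where
  "collection X \<longleftrightarrow> globular_set X \<and> globular_map X (free one_glob) (ar X)"

definition coll_map :: "'a coll \<Rightarrow> 'b coll \<Rightarrow> (nat \<Rightarrow> 'a \<Rightarrow> 'b) \<Rightarrow> bool" where
  "coll_map X Y f \<longleftrightarrow> globular_map X Y f \<and> map_eq X (ar Y \<odot> f) (ar X)"

definition terminal_coll :: "arity coll" where
  "terminal_coll =
     \<lparr>cells = cells (free one_glob), gsrc = gsrc (free one_glob), gtgt = gtgt (free one_glob),
      ar = id_map\<rparr>"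

definition unit_coll :: "unit coll" where
  "unit_coll =
     \<lparr>cells = cells one_glob, gsrc = gsrc one_glob, gtgt = gtgt one_glob,
      ar = free_unit one_glob\<rparr>"

definition proj1 :: "nat \<Rightarrow> 'a \<times> 'b \<Rightarrow> 'a" where
  "proj1 k p = fst p"

definition proj2 :: "nat \<Rightarrow> 'a \<times> 'b \<Rightarrow> 'b" where
  "proj2 k p = snd p"

subsection \<open>Cartesian product\<close>

definition cprod :: "'a coll \<Rightarrow> 'b coll \<Rightarrow> ('a \<times> 'b) coll"  (infixr \<open>\<times>\<^sub>c\<close> 70) where
  "X \<times>\<^sub>c Y =
     \<lparr>cells = (\<lambda>k. {(x, y). x \<in> cells X k \<and> y \<in> cells Y k \<and> ar X k x = ar Y k y}),
      gsrc = (\<lambda>k. map_prod (gsrc X k) (gsrc Y k)),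
      gtgt = (\<lambda>k. map_prod (gtgt X k) (gtgt Y k)),
      ar = (\<lambda>k (x, y). ar X k x)\<rparr>"

definition cprod_map ::
  "(nat \<Rightarrow> 'a \<Rightarrow> 'c) \<Rightarrow> (nat \<Rightarrow> 'b \<Rightarrow> 'd) \<Rightarrow> nat \<Rightarrow> 'a \<times> 'b \<Rightarrow> 'c \<times> 'd" where
  "cprod_map f g k = map_prod (f k) (g k)"

definition cprod_assoc :: "nat \<Rightarrow> ('a \<times> 'b) \<times> 'c \<Rightarrow> 'a \<times> 'b \<times> 'c" where
  "cprod_assoc k = (\<lambda>((x, y), z). (x, (y, z)))"

subsection \<open>Composition tensor product\<close>

definition tens :: "'a coll \<Rightarrow> 'b coll \<Rightarrow> ('a \<times> 'b gterm set) coll"  (infixr \<open>\<box>\<close> 70) where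
  "X \<box> Y =
     \<lparr>cells = (\<lambda>k. {(x, c). x \<in> cells X k \<and> c \<in> cells (free Y) k \<and>
                             ar X k x = free_map one_glob bang k c}),
      gsrc = (\<lambda>k. map_prod (gsrc X k) (gsrc (free Y) k)),
      gtgt = (\<lambda>k. map_prod (gtgt X k) (gtgt (free Y) k)),
      ar = (\<lambda>k (x, c). free_mult one_glob k (free_map (free one_glob) (ar Y) k c))\<rparr>"

text \<open>\<open>tens_map Y' f g\<close> is the tensor product of \<open>f\<close> with a map \<open>g\<close> whose codomain is \<open>Y'\<close>.\<close>

definition tens_map ::
  "'d coll \<Rightarrow> (nat \<Rightarrow> 'a \<Rightarrow> 'c) \<Rightarrow> (nat \<Rightarrow> 'b \<Rightarrow> 'd) \<Rightarrow>
     nat \<Rightarrow> 'a \<times> 'b gterm set \<Rightarrow> 'c \<times> 'd gterm set" where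
  "tens_map Y' f g k = map_prod (f k) (free_map Y' g k)"

text \<open>The associator, in the direction \<open>X \<box> (Y \<box> Z) \<rightarrow> (X \<box> Y) \<box> Z\<close>, in which it is
  induced by the two projections of \<open>Y \<box> Z\<close> to \<open>Y\<close> and to the free category on \<open>Z\<close>. (It is
  invertible because the monad is cartesian.)\<close>

definition tens_assoc ::
  "'b coll \<Rightarrow> 'c coll \<Rightarrow>
     nat \<Rightarrow> 'a \<times> ('b \<times> 'c gterm set) gterm set \<Rightarrow> ('a \<times> 'b gterm set) \<times> 'c gterm set" where
  "tens_assoc Y Z k =
     (\<lambda>(x, c). ((x, free_map Y proj1 k c), free_mult Z k (free_map (free Z) proj2 k c)))"

text \<open>The left unitor, in the direction \<open>X \<rightarrow> I \<box> X\<close>; the right unitor \<open>X \<box> I \<rightarrow> X\<close> is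
  the projection \<open>proj1\<close>, as \<open>bang\<close> is the identity on the terminal globular set.\<close>

definition tens_unit_left :: "'a coll \<Rightarrow> nat \<Rightarrow> 'a \<Rightarrow> unit \<times> 'a gterm set" where
  "tens_unit_left X k x = ((), free_unit X k x)"

text \<open>The map from \<open>(A \<times> B) \<box> (C \<times> D)\<close> to \<open>(A \<box> C) \<times> (B \<box> D)\<close>.\<close>

definition tens_interchange ::
  "'c coll \<Rightarrow> 'd coll \<Rightarrow>
     nat \<Rightarrow> ('a \<times> 'b) \<times> ('c \<times> 'd) gterm set \<Rightarrow> ('a \<times> 'c gterm set) \<times> ('b \<times> 'd gterm set)" where
  "tens_interchange C D k =
     (\<lambda>((a, b), c). ((a, free_map C proj1 k c), (b, free_map D proj2 k c)))"

text \<open>The canonical isomorphism \<open>I \<rightarrow> I \<times> I\<close>.\<close>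

definition unit_diag :: "nat \<Rightarrow> unit \<Rightarrow> unit \<times> unit" where
  "unit_diag k x = (x, x)"

text \<open>The monoid multiplication on the terminal collection is the unique collection map into it,
  that is, the arity map of its domain.\<close>

definition terminal_mult :: "nat \<Rightarrow> arity \<times> arity gterm set \<Rightarrow> arity" where
  "terminal_mult = ar (terminal_coll \<box> terminal_coll)"


section \<open>PROs\<close>

record 'p pro =
  Hom :: "nat \<Rightarrow> nat \<Rightarrow> 'p set"
  Comp :: "nat \<Rightarrow> nat \<Rightarrow> nat \<Rightarrow> 'p \<Rightarrow> 'p \<Rightarrow> 'p"
  Ident :: "nat \<Rightarrow> 'p"
  Sum :: "nat \<Rightarrow> nat \<Rightarrow> nat \<Rightarrow> nat \<Rightarrow> 'p \<Rightarrow> 'p \<Rightarrow> 'p"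

text \<open>\<open>Comp P n m l g f\<close> is \<open>g\<close> after \<open>f\<close> for \<open>f : n \<rightarrow> m\<close> and \<open>g : m \<rightarrow> l\<close>; \<open>Sum P n m l k f g\<close>
  is \<open>f + g\<close> for \<open>f : n \<rightarrow> m\<close> and \<open>g : l \<rightarrow> k\<close>. Operations are indexed by objects since hom-sets
  need not be disjoint.\<close>

definition PRO :: "'p pro \<Rightarrow> bool" where
  "PRO P \<longleftrightarrow>
     (\<forall>n m l. \<forall>g\<in>Hom P m l. \<forall>f\<in>Hom P n m. Comp P n m l g f \<in> Hom P n l) \<and>
     (\<forall>n. Ident P n \<in> Hom P n n) \<and>
     (\<forall>n m l r. \<forall>h\<in>Hom P l r. \<forall>g\<in>Hom P m l. \<forall>f\<in>Hom P n m.
        Comp P n m r (Comp P m l r h g) f = Comp P n l r h (Comp P n m l g f)) \<and>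
     (\<forall>n m. \<forall>f\<in>Hom P n m.
        Comp P n m m (Ident P m) f = f \<and> Comp P n n m f (Ident P n) = f) \<and>
     (\<forall>n m l k. \<forall>f\<in>Hom P n m. \<forall>g\<in>Hom P l k. Sum P n m l k f g \<in> Hom P (n + l) (m + k)) \<and>
     (\<forall>n m r l k s. \<forall>f\<in>Hom P n m. \<forall>f'\<in>Hom P m r. \<forall>g\<in>Hom P l k. \<forall>g'\<in>Hom P k s.
        Comp P (n + l) (m + k) (r + s) (Sum P m r k s f' g') (Sum P n m l k f g) =
        Sum P n r l s (Comp P n m r f' f) (Comp P l k s g' g)) \<and>
     (\<forall>n m. Sum P n n m m (Ident P n) (Ident P m) = Ident P (n + m)) \<and>
     (\<forall>n m l k r s. \<forall>f\<in>Hom P n m. \<forall>g\<in>Hom P l k. \<forall>h\<in>Hom P r s.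
        Sum P (n + l) (m + k) r s (Sum P n m l k f g) h =
        Sum P n m (l + r) (k + s) f (Sum P l k r s g h)) \<and>
     (\<forall>n m. \<forall>f\<in>Hom P n m.
        Sum P 0 0 n m (Ident P 0) f = f \<and> Sum P n m 0 0 f (Ident P 0) = f)"


section \<open>Globular PROs\<close>

record 'a gpro =
  ghom :: "nat \<Rightarrow> nat \<Rightarrow> 'a coll"
  gcomp :: "nat \<Rightarrow> nat \<Rightarrow> nat \<Rightarrow> nat \<Rightarrow> 'a \<times> 'a gterm set \<Rightarrow> 'a"
  gident :: "nat \<Rightarrow> nat \<Rightarrow> unit \<Rightarrow> 'a"
  gplus :: "nat \<Rightarrow> nat \<Rightarrow> nat \<Rightarrow> nat \<Rightarrow> nat \<Rightarrow> 'a \<times> 'a \<Rightarrow> 'a"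
  gunit :: "nat \<Rightarrow> arity \<Rightarrow> 'a"

definition globular_category :: "'a gpro \<Rightarrow> bool" where
  "globular_category Q \<longleftrightarrow>
     (\<forall>n m. collection (ghom Q n m)) \<and>
     (\<forall>n m l. coll_map (ghom Q m l \<box> ghom Q n m) (ghom Q n l) (gcomp Q n m l)) \<and>
     (\<forall>n. coll_map unit_coll (ghom Q n n) (gident Q n)) \<and>
     (\<forall>n m l r. map_eq (ghom Q l r \<box> (ghom Q m l \<box> ghom Q n m))
        (gcomp Q n m r \<odot> tens_map (ghom Q n m) (gcomp Q m l r) id_map
           \<odot> tens_assoc (ghom Q m l) (ghom Q n m))
        (gcomp Q n l r \<odot> tens_map (ghom Q n l) id_map (gcomp Q n m l))) \<and>
     (\<forall>n m. map_eq (ghom Q n m)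
        (gcomp Q n m m \<odot> tens_map (ghom Q n m) (gident Q m) id_map \<odot> tens_unit_left (ghom Q n m))
        id_map) \<and>
     (\<forall>n m. map_eq (ghom Q n m \<box> unit_coll)
        (gcomp Q n n m \<odot> tens_map (ghom Q n n) id_map (gident Q n))
        proj1)"

definition globular_sum :: "'a gpro \<Rightarrow> bool" where
  "globular_sum Q \<longleftrightarrow>
     (\<forall>n m l k. coll_map (ghom Q n m \<times>\<^sub>c ghom Q l k) (ghom Q (n + l) (m + k)) (gplus Q n m l k)) \<and>
     (\<forall>n m r l k s. map_eq ((ghom Q m r \<times>\<^sub>c ghom Q k s) \<box> (ghom Q n m \<times>\<^sub>c ghom Q l k))
        (gcomp Q (n + l) (m + k) (r + s)
           \<odot> tens_map (ghom Q (n + l) (m + k)) (gplus Q m r k s) (gplus Q n m l k))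
        (gplus Q n r l s \<odot> cprod_map (gcomp Q n m r) (gcomp Q l k s)
           \<odot> tens_interchange (ghom Q n m) (ghom Q l k))) \<and>
     (\<forall>n m. map_eq unit_coll
        (gplus Q n n m m \<odot> cprod_map (gident Q n) (gident Q m) \<odot> unit_diag)
        (gident Q (n + m))) \<and>
     (\<forall>n m l k r s. map_eq ((ghom Q n m \<times>\<^sub>c ghom Q l k) \<times>\<^sub>c ghom Q r s)
        (gplus Q (n + l) (m + k) r s \<odot> cprod_map (gplus Q n m l k) id_map)
        (gplus Q n m (l + r) (k + s) \<odot> cprod_map id_map (gplus Q l k r s) \<odot> cprod_assoc))"

definition globular_unit :: "'a gpro \<Rightarrow> bool" where
  "globular_unit Q \<longleftrightarrow>
     coll_map terminal_coll (ghom Q 0 0) (gunit Q) \<and>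
     map_eq (terminal_coll \<box> terminal_coll)
       (gcomp Q 0 0 0 \<odot> tens_map (ghom Q 0 0) (gunit Q) (gunit Q))
       (gunit Q \<odot> terminal_mult) \<and>
     map_eq unit_coll (gunit Q \<odot> free_unit one_glob) (gident Q 0) \<and>
     (\<forall>n m. map_eq (terminal_coll \<times>\<^sub>c ghom Q n m)
        (gplus Q 0 0 n m \<odot> cprod_map (gunit Q) id_map) proj2) \<and>
     (\<forall>n m. map_eq (ghom Q n m \<times>\<^sub>c terminal_coll)
        (gplus Q n m 0 0 \<odot> cprod_map id_map (gunit Q)) proj1)"

definition globular_PRO :: "'a gpro \<Rightarrow> bool" where
  "globular_PRO Q \<longleftrightarrow> globular_category Q \<and> globular_sum Q \<and> globular_unit Q"


section \<open>Globularization\<close>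

text \<open>The coproduct of \<open>A\<close>-many copies of \<open>X\<close>, its inclusions and its functoriality.\<close>

definition copower :: "'i set \<Rightarrow> 'a coll \<Rightarrow> ('i \<times> 'a) coll"  (infixr \<open>\<cdot>\<^sub>c\<close> 75) where
  "A \<cdot>\<^sub>c X =
     \<lparr>cells = (\<lambda>k. A \<times> cells X k),
      gsrc = (\<lambda>k (a, x). (a, gsrc X k x)),
      gtgt = (\<lambda>k (a, x). (a, gtgt X k x)),
      ar = (\<lambda>k (a, x). ar X k x)\<rparr>"

definition incl :: "'i \<Rightarrow> nat \<Rightarrow> 'a \<Rightarrow> 'i \<times> 'a" where
  "incl a k x = (a, x)"

definition copower_map :: "('i \<Rightarrow> 'j) \<Rightarrow> (nat \<Rightarrow> 'a \<Rightarrow> 'b) \<Rightarrow> nat \<Rightarrow> 'i \<times> 'a \<Rightarrow> 'j \<times> 'b" where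
  "copower_map h f k = map_prod h (f k)"

text \<open>The canonical comparison maps from \<open>(A \<times> B) \<cdot>\<^sub>c (X \<box> Y)\<close> to \<open>(A \<cdot>\<^sub>c X) \<box> (B \<cdot>\<^sub>c Y)\<close>
  and from \<open>(A \<times> B) \<cdot>\<^sub>c (X \<times>\<^sub>c Y)\<close> to \<open>(A \<cdot>\<^sub>c X) \<times>\<^sub>c (B \<cdot>\<^sub>c Y)\<close>, given on the summand
  indexed by \<open>(a, b)\<close> by \<open>incl a \<box> incl b\<close> and by \<open>incl a \<times> incl b\<close> respectively. They are
  isomorphisms; \<open>inv_on\<close> takes their inverses.\<close>

definition distr_tens ::
  "'j set \<Rightarrow> 'b coll \<Rightarrow>
     nat \<Rightarrow> ('i \<times> 'j) \<times> ('a \<times> 'b gterm set) \<Rightarrow> ('i \<times> 'a) \<times> ('j \<times> 'b) gterm set" where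
  "distr_tens B Y k = (\<lambda>((a, b), z). tens_map (B \<cdot>\<^sub>c Y) (incl a) (incl b) k z)"

definition distr_cprod ::
  "nat \<Rightarrow> ('i \<times> 'j) \<times> ('a \<times> 'b) \<Rightarrow> ('i \<times> 'a) \<times> ('j \<times> 'b)" where
  "distr_cprod k = (\<lambda>((a, b), z). cprod_map (incl a) (incl b) k z)"

definition inv_on :: "('a, 'z) glob_scheme \<Rightarrow> (nat \<Rightarrow> 'a \<Rightarrow> 'b) \<Rightarrow> nat \<Rightarrow> 'b \<Rightarrow> 'a" where
  "inv_on X f k = inv_into (cells X k) (f k)"

text \<open>The canonical isomorphism from the product of two copies of the terminal collection to the
  terminal collection is either projection.\<close>

definition globularization :: "'p pro \<Rightarrow> ('p \<times> arity) gpro" where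
  "globularization P =
     \<lparr>ghom = (\<lambda>n m. Hom P n m \<cdot>\<^sub>c terminal_coll),
      gcomp = (\<lambda>n m l. copower_map (\<lambda>(g, f). Comp P n m l g f) terminal_mult
                \<odot> inv_on ((Hom P m l \<times> Hom P n m) \<cdot>\<^sub>c (terminal_coll \<box> terminal_coll))
                    (distr_tens (Hom P n m) terminal_coll)),
      gident = (\<lambda>n. incl (Ident P n) \<odot> free_unit one_glob),
      gplus = (\<lambda>n m l k. copower_map (\<lambda>(f, g). Sum P n m l k f g) proj1
                \<odot> inv_on ((Hom P n m \<times> Hom P l k) \<cdot>\<^sub>c (terminal_coll \<times>\<^sub>c terminal_coll))
                    distr_cprod),
      gunit = incl (Ident P 0)\<rparr>"

end

theory Submission
  imports Defs
begin

text \<open>A collection map into \<open>A \<cdot>\<^sub>c terminal_coll\<close> is determined by its component in \<open>A\<close>, because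
  the other component is the arity. All structure maps of the globularization are collection maps
  into collections of this form, so each axiom reduces to an equation between labels in \<open>P\<close>. On
  labels, the free category monad is harmless: pasting diagrams are connected, so a cell of the free
  category on \<open>B \<cdot>\<^sub>c Y\<close> amounts to a single label in \<open>B\<close> and a cell of the free category on
  \<open>Y\<close>, and the label equations are the laws of the PRO. That the canonical maps preserve arities
  comes down to the monad laws, which in turn rest on the fact that \<open>teq\<close> respects sources and
  targets.\<close>

section \<open>Boundaries of formal composites\<close>

text \<open>The free category is presented by syntax, not by trees or normal forms: its cells are
  classes of a partial equivalence in which composition has a side condition that is itself an
  equation of lower dimension. Boundaries, \<open>free_map\<close> and \<open>free_mult\<close> are
  unions over representatives, so none of them can be evaluated before it is known that the
  representative does not matter. Equality of two cells of a free category is never decided by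
  computation; functoriality, the monad laws and one invariant, the label, suffice. The
  multiplication brings a second difficulty: \<open>tflat\<close> picks representatives by choice,
  so it commutes with boundaries and with \<open>tmap\<close> only up to \<open>teq\<close>. Its
  laws are therefore proved for terms up to \<open>teq\<close> and become equations only on classes.
  In exchange, the label of a transported diagram depends on the value of the map at a single cell.
  This turns associativity and functoriality, which speak of whole diagrams, into one instance of
  the corresponding law of \<open>P\<close>.\<close>

lemma iter_bd_same [simp]: "iter_bd d k k x = x"
  by (cases k) auto

lemma iter_bd_Suc [simp]: "k \<le> n \<Longrightarrow> iter_bd d k (Suc n) x = iter_bd d k n (d n x)"
  by simp

declare iter_bd.simps(2) [simp del]

lemma iter_bd_iter_bd: "j \<le> k \<Longrightarrow> k \<le> n \<Longrightarrow> iter_bd d j k (iter_bd d k n x) = iter_bd d j n x"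
  by (induction n arbitrary: x) (auto simp: le_Suc_eq)

text \<open>On the way down from dimension \<open>n\<close> the boundary is taken factor by factor,
  until the step from dimension \<open>k + 1\<close> to \<open>k\<close> discards one factor for
  good; below \<open>k\<close> only the surviving factor is seen.\<close>

lemma tsrc_to_Cmp:
  assumes "k < n" "j \<le> n"
  shows "tsrc_to X j n (Cmp k u v) =
    (if j \<le> k then tsrc_to X j n v else Cmp k (tsrc_to X j n u) (tsrc_to X j n v))"
  using assms
proof (induction n arbitrary: u v)
  case (Suc n)
  then show ?case by (cases "j \<le> n") (auto simp: le_Suc_eq)
qed simp

lemma ttgt_to_Cmp:
  assumes "k < n" "j \<le> n"
  shows "ttgt_to X j n (Cmp k u v) =
    (if j \<le> k then ttgt_to X j n u else Cmp k (ttgt_to X j n u) (ttgt_to X j n v))"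
  using assms
proof (induction n arbitrary: u v)
  case (Suc n)
  then show ?case by (cases "j \<le> n") (auto simp: le_Suc_eq)
qed simp

lemma tsrc_to_Idt_pow: "k \<le> n \<Longrightarrow> tsrc_to X k n ((Idt ^^ (n - k)) u) = u"
  by (induction n) (auto simp: le_Suc_eq Suc_diff_le)

lemma ttgt_to_Idt_pow: "k \<le> n \<Longrightarrow> ttgt_to X k n ((Idt ^^ (n - k)) u) = u"
  by (induction n) (auto simp: le_Suc_eq Suc_diff_le)

section \<open>One-step boundaries: congruence and the globular identities up to
  \<open>teq\<close>\<close>

definition composable :: "('a, 'z) glob_scheme \<Rightarrow> nat \<Rightarrow> nat \<Rightarrow> 'a gterm \<Rightarrow> 'a gterm \<Rightarrow> bool" where
  "composable X k n u v \<longleftrightarrow> teq X k (tsrc_to X k n u) (ttgt_to X k n v)"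

text \<open>Guarding by \<open>n = Suc m\<close> makes the condition vacuous in dimension 0, where
  there is no boundary, so that statements can be uniform in \<open>n\<close>.
  \<open>bd_glob\<close> is guarded in the same way and is vacuous below dimension 2.\<close>

definition bd_cong :: "('a, 'z) glob_scheme \<Rightarrow> nat \<Rightarrow> 'a gterm \<Rightarrow> 'a gterm \<Rightarrow> bool" where
  "bd_cong X n u v \<longleftrightarrow> (\<forall>m. n = Suc m \<longrightarrow>
     teq X m (tsrc X m u) (tsrc X m v) \<and> teq X m (ttgt X m u) (ttgt X m v))"

definition bd_glob :: "('a, 'z) glob_scheme \<Rightarrow> nat \<Rightarrow> 'a gterm \<Rightarrow> bool" where
  "bd_glob X n u \<longleftrightarrow> (\<forall>l. n = Suc (Suc l) \<longrightarrow>
     teq X l (tsrc X l (tsrc X (Suc l) u)) (tsrc X l (ttgt X (Suc l) u)) \<and>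
     teq X l (ttgt X l (tsrc X (Suc l) u)) (ttgt X l (ttgt X (Suc l) u)))"

lemma teq_refl_left: "teq X n u v \<Longrightarrow> teq X n u u"
  by (meson teq_sym teq_trans)

lemma teq_refl_right: "teq X n u v \<Longrightarrow> teq X n v v"
  by (meson teq_sym teq_trans)

lemma teq_Cmp:
  "k < n \<Longrightarrow> teq X n u u' \<Longrightarrow> teq X n v v' \<Longrightarrow> composable X k n u v \<Longrightarrow>
    teq X n (Cmp k u v) (Cmp k u' v')"
  unfolding composable_def by (rule teq_cmp)

lemma teq_Idt_pow: "teq X k u u' \<Longrightarrow> k \<le> n \<Longrightarrow> teq X n ((Idt ^^ (n - k)) u) ((Idt ^^ (n - k)) u')"
proof (induction n)
  case (Suc n)
  then show ?case by (cases "k \<le> n") (auto simp: le_Suc_eq Suc_diff_le intro: teq_idt)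
qed simp

lemma bd_congD:
  "bd_cong X (Suc m) u v \<Longrightarrow> teq X m (tsrc X m u) (tsrc X m v)"
  "bd_cong X (Suc m) u v \<Longrightarrow> teq X m (ttgt X m u) (ttgt X m v)"
  by (auto simp: bd_cong_def)

lemma bd_globD:
  "bd_glob X (Suc (Suc l)) u \<Longrightarrow>
    teq X l (tsrc X l (tsrc X (Suc l) u)) (tsrc X l (ttgt X (Suc l) u))"
  "bd_glob X (Suc (Suc l)) u \<Longrightarrow>
    teq X l (ttgt X l (tsrc X (Suc l) u)) (ttgt X l (ttgt X (Suc l) u))"
  by (auto simp: bd_glob_def)

definition bd_below :: "('a, 'z) glob_scheme \<Rightarrow> nat \<Rightarrow> bool" where
  "bd_below X n \<longleftrightarrow>
    (\<forall>m<n. \<forall>u v. teq X m u v \<longrightarrow> bd_cong X m u v \<and> bd_glob X m u \<and> bd_glob X m v)"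

lemma bd_belowD:
  "bd_below X n \<Longrightarrow> m < n \<Longrightarrow> teq X m u v \<Longrightarrow> bd_cong X m u v \<and> bd_glob X m u \<and> bd_glob X m v"
  by (simp add: bd_below_def)

lemma bd_cong_sym: "bd_cong X n u v \<Longrightarrow> bd_cong X n v u"
  by (auto simp: bd_cong_def intro: teq_sym)

lemma bd_cong_trans: "bd_cong X n u v \<Longrightarrow> bd_cong X n v w \<Longrightarrow> bd_cong X n u w"
  by (auto simp: bd_cong_def intro: teq_trans)

lemma bd_cong_refl_left: "bd_cong X n u v \<Longrightarrow> bd_cong X n u u"
  by (meson bd_cong_sym bd_cong_trans)

lemma bd_cong_refl_right: "bd_cong X n u v \<Longrightarrow> bd_cong X n v v"
  by (meson bd_cong_sym bd_cong_trans)

text \<open>Compatibility of \<open>teq\<close> with boundaries needs an induction on the dimension around the rule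
  induction, because composability in dimension \<open>n\<close> is tested in dimensions \<open>k < n\<close>. The
  hypothesis of the outer induction is \<open>bd_below\<close>.\<close>

context
  fixes X :: "('a, 'z) glob_scheme" and n :: nat
  assumes below: "bd_below X n"
begin

lemmas low = bd_belowD[OF below]

lemma low_iter:
  "m < n \<Longrightarrow> k \<le> m \<Longrightarrow> teq X m u v \<Longrightarrow>
    teq X k (tsrc_to X k m u) (tsrc_to X k m v) \<and> teq X k (ttgt_to X k m u) (ttgt_to X k m v)"
proof (induction m arbitrary: u v)
  case (Suc m)
  show ?case
  proof (cases "k \<le> m")
    case True
    then show ?thesis using Suc low[OF Suc.prems(1) Suc.prems(3)] bd_congD[of X m u v] by simp
  next
    case False
    then show ?thesis using Suc by (simp add: le_Suc_eq)
  qed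
qed simp

text \<open>In dimension \<open>n\<close> itself the hypothesis on the pair supplies the first
  boundary step; the remaining steps live below \<open>n\<close>, where \<open>low_iter\<close>
  applies.\<close>

lemma low_iter_cong:
  assumes "bd_cong X n u v" "k < n"
  shows "teq X k (tsrc_to X k n u) (tsrc_to X k n v)" "teq X k (ttgt_to X k n u) (ttgt_to X k n v)"
proof -
  obtain m where m: "n = Suc m" using assms(2) by (cases n) auto
  then show "teq X k (tsrc_to X k n u) (tsrc_to X k n v)"
    "teq X k (ttgt_to X k n u) (ttgt_to X k n v)"
    using assms low_iter[of m k] bd_congD[of X m u v] by auto
qed

text \<open>One further boundary step erases the difference between the source and the target of
  \<open>u\<close>. Hence the strict bound \<open>k < m\<close>: in dimension \<open>m\<close>
  itself the two may still differ.\<close>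

lemma low_iter_glob:
  assumes "bd_glob X (Suc m) u" "Suc m \<le> n" "k < m"
  shows "teq X k (tsrc_to X k m (tsrc X m u)) (tsrc_to X k m (ttgt X m u))"
    "teq X k (ttgt_to X k m (tsrc X m u)) (ttgt_to X k m (ttgt X m u))"
proof -
  obtain l where l: "m = Suc l" using assms(3) by (cases m) auto
  then show "teq X k (tsrc_to X k m (tsrc X m u)) (tsrc_to X k m (ttgt X m u))"
    "teq X k (ttgt_to X k m (tsrc X m u)) (ttgt_to X k m (ttgt X m u))"
    using assms low_iter[of l k] bd_globD[of X l u] by auto
qed

text \<open>Composability compares a \<open>k\<close>-source with a \<open>k\<close>-target, and for
  \<open>k < m\<close> these do not depend on whether the first step down takes the source or the
  target. For sources the switch is made on \<open>v\<close>, for targets on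
  \<open>u\<close>.\<close>

lemma composable_bd:
  assumes "Suc m \<le> n" "k < m" "bd_glob X (Suc m) u" "bd_glob X (Suc m) v"
    and "composable X k (Suc m) u v"
  shows "composable X k m (tsrc X m u) (tsrc X m v)" "composable X k m (ttgt X m u) (ttgt X m v)"
  using assms low_iter_glob[OF assms(3,1,2)] low_iter_glob[OF assms(4,1,2)]
  unfolding composable_def by (auto intro: teq_trans teq_sym)

text \<open>Along the top dimension the boundary of a composite is the boundary of one factor. Along
  a lower one it is the composite of the boundaries, which is legitimate by
  \<open>composable_bd\<close>.\<close>

lemma bd_cong_Cmp:
  assumes "k < n" "bd_cong X n u u'" "bd_cong X n v v'" "bd_glob X n u" "bd_glob X n v"
    and "composable X k n u v"
  shows "bd_cong X n (Cmp k u v) (Cmp k u' v')"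
  unfolding bd_cong_def
proof (intro allI impI)
  fix m assume m: "n = Suc m"
  show "teq X m (tsrc X m (Cmp k u v)) (tsrc X m (Cmp k u' v')) \<and>
    teq X m (ttgt X m (Cmp k u v)) (ttgt X m (Cmp k u' v'))"
  proof (cases "k = m")
    case True
    then show ?thesis using assms m bd_congD by auto
  next
    case False
    then have k: "k < m" using assms(1) m by simp
    note c = composable_bd[OF _ k assms(4-6)[unfolded m]]
    show ?thesis using c assms m k bd_congD[of X m] False by (auto intro!: teq_Cmp)
  qed
qed

lemma bd_glob_Cmp:
  assumes "k < n" "bd_cong X n u u" "bd_cong X n v v" "bd_glob X n u" "bd_glob X n v"
    and "composable X k n u v"
  shows "bd_glob X n (Cmp k u v)"
  unfolding bd_glob_def
proof (intro allI impI)
  fix l assume l: "n = Suc (Suc l)"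
  have su: "teq X (Suc l) (tsrc X (Suc l) u) (tsrc X (Suc l) u)"
    and tu: "teq X (Suc l) (ttgt X (Suc l) u) (ttgt X (Suc l) u)"
    and sv: "teq X (Suc l) (tsrc X (Suc l) v) (tsrc X (Suc l) v)"
    and tv: "teq X (Suc l) (ttgt X (Suc l) v) (ttgt X (Suc l) v)"
    using assms l bd_congD[of X "Suc l"] by auto
  note gu = bd_globD[OF assms(4)[unfolded l]] and gv = bd_globD[OF assms(5)[unfolded l]]
  consider "k = Suc l" | "k = l" | "k < l" using assms(1) l by linarith
  then show "teq X l (tsrc X l (tsrc X (Suc l) (Cmp k u v))) (tsrc X l (ttgt X (Suc l) (Cmp k u v))) \<and>
    teq X l (ttgt X l (tsrc X (Suc l) (Cmp k u v))) (ttgt X l (ttgt X (Suc l) (Cmp k u v)))"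
  proof cases
    case 1
    \<comment> \<open>The composite has the source of \<open>v\<close> and the target of
      \<open>u\<close>. They are parallel because both are parallel to the common boundary, which is
      the source of \<open>u\<close> and the target of \<open>v\<close>.\<close>
    have "teq X (Suc l) (tsrc X (Suc l) u) (ttgt X (Suc l) v)"
      using assms(6) 1 l by (simp add: composable_def)
    then have "bd_cong X (Suc l) (tsrc X (Suc l) u) (ttgt X (Suc l) v)"
      using low l by simp
    note c = bd_congD[OF this]
    have "teq X l (tsrc X l (tsrc X (Suc l) v)) (tsrc X l (ttgt X (Suc l) u))"
      "teq X l (ttgt X l (tsrc X (Suc l) v)) (ttgt X l (ttgt X (Suc l) u))"
      using gu gv c by (meson teq_sym teq_trans)+
    then show ?thesis using 1 by simp
  next
    case 2
    then show ?thesis using gu gv by auto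
  next
    case 3
    have n: "n = Suc (Suc l)" "k < Suc l" "Suc l < n" using l 3 by auto
    note c = composable_bd[OF _ n(2) assms(4-6)[unfolded n(1)]]
    \<comment> \<open>The second boundary step is again one through a composite, so
      \<open>composable_bd\<close> is used twice; the second use needs the globular identities for
      the boundaries of \<open>u\<close> and \<open>v\<close>, which lie below
      \<open>n\<close>.\<close>
    have "\<And>w. teq X (Suc l) w w \<Longrightarrow> bd_glob X (Suc l) w"
      using low n by simp
    note g = this[OF su] this[OF tu] this[OF sv] this[OF tv]
    have "composable X k l (tsrc X l (tsrc X (Suc l) u)) (tsrc X l (tsrc X (Suc l) v))"
      "composable X k l (ttgt X l (tsrc X (Suc l) u)) (ttgt X l (tsrc X (Suc l) v))"
      using composable_bd[OF _ 3 g(1,3)] composable_bd[OF _ 3 g(2,4)] c n by auto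
    then show ?thesis using gu gv 3 by (auto intro!: teq_Cmp)
  qed
qed


text \<open>Repeated use of the globular identities: a route from dimension \<open>m\<close> to
  \<open>j\<close> may switch between sources and targets at the intermediate dimension
  \<open>k\<close>, and only the choice made below \<open>k\<close> survives. Interchange needs this
  because it mixes boundaries of two dimensions.\<close>

lemma low_iter_mixed:
  assumes "m \<le> n" "bd_cong X m w w" "bd_glob X m w" "j < k" "k < m"
  shows "teq X j (tsrc_to X j k (ttgt_to X k m w)) (tsrc_to X j m w)"
    "teq X j (ttgt_to X j k (tsrc_to X k m w)) (ttgt_to X j m w)"
proof -
  have "teq X j (tsrc_to X j k (ttgt_to X k m w)) (tsrc_to X j m w) \<and>
    teq X j (ttgt_to X j k (tsrc_to X k m w)) (ttgt_to X j m w)"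
    using assms
  proof (induction m arbitrary: w)
    case (Suc m)
    note g = low_iter_glob[OF Suc.prems(3,1), of j]
    show ?case
    proof (cases "k = m")
      case True
      then show ?thesis using g Suc.prems by (auto intro: teq_sym)
    next
      case False
      then have k: "k < m" using Suc.prems by simp
      note b = bd_congD[OF Suc.prems(2)]
      have "m < n" using Suc.prems by simp
      then show ?thesis
        using Suc.IH[of "tsrc X m w"] Suc.IH[of "ttgt X m w"] low[OF _ b(1)] low[OF _ b(2)] k
          Suc.prems g by (auto intro: teq_sym teq_trans)
    qed
  qed simp
  then show "teq X j (tsrc_to X j k (ttgt_to X k m w)) (tsrc_to X j m w)"
    "teq X j (ttgt_to X j k (tsrc_to X k m w)) (ttgt_to X j m w)" by auto
qed

text \<open>The premises of the interchange rule speak about the four cells, not about the two pairs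
  of composites formed from them. The missing facts come from comparing \<open>j\<close>-boundaries
  with those of the shared \<open>k\<close>-boundaries.\<close>

lemma composable_interchange:
  assumes "j < k" "k < n" "bd_cong X n u u" "bd_glob X n u" "bd_cong X n v v" "bd_glob X n v"
    "bd_cong X n u' u'" "bd_glob X n u'" "bd_cong X n v' v'" "bd_glob X n v'"
    "composable X k n u v" "composable X k n u' v'" "composable X j n u u'" "composable X j n v v'"
  shows "composable X j n (Cmp k u v) (Cmp k u' v')"
    "composable X k n (Cmp j u u') (Cmp j v v')"
proof -
  note mix = low_iter_mixed[OF order_refl _ _ assms(1,2)]
  \<comment> \<open>The common \<open>k\<close>-boundary of \<open>u\<close> and \<open>v\<close>
    forces their \<open>j\<close>-sources to agree; so the \<open>j\<close>-source of
    \<open>v\<close>, which is that of \<open>Cmp k u v\<close>, matches the \<open>j\<close>-target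
    of \<open>u'\<close>.\<close>
  have "teq X j (tsrc_to X j k (tsrc_to X k n u)) (tsrc_to X j k (ttgt_to X k n v))"
    using assms low_iter[of k j] by (simp add: composable_def)
  then have "teq X j (tsrc_to X j n v) (tsrc_to X j n u)"
    using mix(1)[OF assms(5,6)] assms(1,2) by (simp add: iter_bd_iter_bd) (meson teq_sym teq_trans)
  then show "composable X j n (Cmp k u v) (Cmp k u' v')"
    using assms by (auto simp: composable_def tsrc_to_Cmp ttgt_to_Cmp intro: teq_trans)
  have "composable X j k (tsrc_to X k n u) (tsrc_to X k n u')"
    using assms mix(2)[OF assms(7,8)]
    by (auto simp: composable_def iter_bd_iter_bd intro: teq_sym teq_trans)
  then show "composable X k n (Cmp j u u') (Cmp j v v')"
    using assms unfolding composable_def[of X k n]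
    by (auto simp: tsrc_to_Cmp ttgt_to_Cmp intro!: teq_Cmp)
qed

end

section \<open>Identities, and the induction on derivations of \<open>teq\<close>\<close>

lemma bd_cong_Idt: "teq X n u u' \<Longrightarrow> bd_cong X (Suc n) (Idt u) (Idt u')"
  by (auto simp: bd_cong_def)

lemma bd_glob_Idt: "bd_below X (Suc n) \<Longrightarrow> teq X n u u \<Longrightarrow> bd_glob X (Suc n) (Idt u)"
  using bd_belowD[of X "Suc n" n u u] by (auto simp: bd_glob_def bd_cong_def)

text \<open>As \<open>k < n\<close>, the iterated identity is the identity of a cell of dimension
  \<open>n - 1\<close>, so the facts about a single \<open>Idt\<close> apply.\<close>

lemma bd_Idt_pow:
  assumes "bd_below X n" "teq X k a a" "k < n"
  shows "bd_cong X n ((Idt ^^ (n - k)) a) ((Idt ^^ (n - k)) a)" "bd_glob X n ((Idt ^^ (n - k)) a)"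
proof -
  obtain m where m: "n = Suc m" "k \<le> m" using assms(3) by (cases n) auto
  have "teq X m ((Idt ^^ (m - k)) a) ((Idt ^^ (m - k)) a)" using assms m teq_Idt_pow by blast
  then show "bd_cong X n ((Idt ^^ (n - k)) a) ((Idt ^^ (n - k)) a)"
    "bd_glob X n ((Idt ^^ (n - k)) a)"
    using m assms bd_cong_Idt bd_glob_Idt by (auto simp: Suc_diff_le)
qed

text \<open>The assumption \<open>bd_below\<close> is carried through the rule induction because the
  rules for \<open>Idt\<close> change the dimension. Premises in the dimension of the conclusion are
  used through their induction hypotheses; those in lower dimensions enter as composability, and
  \<open>bd_below\<close> transports them.\<close>

lemma teq_bd_step:
  assumes "globular_set X" "teq X n u v" "bd_below X n"
  shows "bd_cong X n u v \<and> bd_glob X n u \<and> bd_glob X n v"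
  using assms(2,3)
proof (induction rule: teq.induct)
  case (teq_gen x n)
  then show ?case using assms(1)
    by (auto simp: globular_set_def bd_cong_def bd_glob_def intro!: teq.teq_gen)
next
  case (teq_idt n u u')
  then show ?case
    using bd_cong_Idt bd_glob_Idt teq_refl_left teq_refl_right by metis
next
  case (teq_cmp k n u u' v v')
  note low = teq_cmp.prems and IH = teq_cmp.IH(1,2)[OF low]
  have c: "composable X k n u v" using teq_cmp by (simp add: composable_def)
  \<comment> \<open>The rule tests composability on one side only. It passes to the other side
    because equal terms have equal boundaries of dimension \<open>k < n\<close>.\<close>
  moreover have "composable X k n u' v'"
    using low_iter_cong[OF low _ teq_cmp.hyps(1), of u u'] c IH
      low_iter_cong[OF low _ teq_cmp.hyps(1), of v v']
    unfolding composable_def by (meson teq_sym teq_trans)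
  ultimately show ?case
    using IH teq_cmp.hyps(1) bd_cong_Cmp[OF low] bd_glob_Cmp[OF low]
    by (meson bd_cong_refl_left bd_cong_refl_right)
next
  case (teq_sym n u v)
  then show ?case using bd_cong_sym by blast
next
  case (teq_trans n u v w)
  then show ?case using bd_cong_trans by blast
next
  case (teq_assoc k n u v w)
  note low = teq_assoc.prems and IH = teq_assoc.IH(1-3)[OF low]
  have c: "composable X k n u v" "composable X k n v w"
    using teq_assoc.hyps by (simp_all add: composable_def)
  then have c': "composable X k n (Cmp k u v) w" "composable X k n u (Cmp k v w)"
    using teq_assoc.hyps(1) by (auto simp: composable_def tsrc_to_Cmp ttgt_to_Cmp)
  have "bd_cong X n (Cmp k (Cmp k u v) w) (Cmp k u (Cmp k v w))"
    unfolding bd_cong_def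
  proof (intro allI impI)
    fix m assume m: "n = Suc m"
    show "teq X m (tsrc X m (Cmp k (Cmp k u v) w)) (tsrc X m (Cmp k u (Cmp k v w))) \<and>
      teq X m (ttgt X m (Cmp k (Cmp k u v) w)) (ttgt X m (Cmp k u (Cmp k v w)))"
    proof (cases "k = m")
      case True
      then show ?thesis using IH m bd_congD[of X m] by auto
    next
      case False
      then have k: "k < m" using m teq_assoc.hyps(1) by simp
      note cb = composable_bd[OF low _ k, folded m, OF order_refl]
      show ?thesis using False k IH m bd_congD[of X m] c cb[of u v] cb[of v w]
        by (simp add: composable_def teq.teq_assoc)
    qed
  qed
  moreover have "bd_glob X n (Cmp k (Cmp k u v) w)" "bd_glob X n (Cmp k u (Cmp k v w))"
    using IH teq_assoc.hyps(1) c c' by (intro bd_glob_Cmp[OF low] bd_cong_Cmp[OF low]; blast)+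
  ultimately show ?case by blast
next
  case (teq_unit_left k n u)
  note low = teq_unit_left.prems and IH = teq_unit_left.IH(1)[OF low]
  let ?a = "ttgt_to X k n u"
  have a: "teq X k ?a ?a" using low_iter_cong[OF low _ teq_unit_left.hyps(1)] IH by blast
  have c: "composable X k n ((Idt ^^ (n - k)) ?a) u"
    using a teq_unit_left.hyps by (simp add: composable_def tsrc_to_Idt_pow)
  have "bd_cong X n (Cmp k ((Idt ^^ (n - k)) ?a) u) u"
    unfolding bd_cong_def
  proof (intro allI impI)
    fix m assume m: "n = Suc m"
    show "teq X m (tsrc X m (Cmp k ((Idt ^^ (n - k)) ?a) u)) (tsrc X m u) \<and>
      teq X m (ttgt X m (Cmp k ((Idt ^^ (n - k)) ?a) u)) (ttgt X m u)"
    proof (cases "k = m")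
      case True
      then show ?thesis using IH m bd_congD[of X m] by auto
    next
      case False
      then have k: "k < m" using m teq_unit_left.hyps(1) by simp
      have s: "teq X m (tsrc X m u) (tsrc X m u)" "teq X m (ttgt X m u) (ttgt X m u)"
        using IH m bd_congD[of X m] by auto
      have e: "?a = ttgt_to X k m (ttgt X m u)" using m k by simp
      \<comment> \<open>Taking sources leaves a unit built on the \<open>k\<close>-target of the
        target of \<open>u\<close>, whereas the unit law for the source of \<open>u\<close> asks for
        the \<open>k\<close>-target of that source. The globular identities exchange the two; for
        targets they agree literally.\<close>
      have "teq X k ?a (ttgt_to X k m (tsrc X m u))"
        unfolding e using low_iter_glob[OF low, of m u k] IH m k teq.teq_sym by blast
      then have "teq X m (Cmp k ((Idt ^^ (m - k)) ?a) (tsrc X m u))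
        (Cmp k ((Idt ^^ (m - k)) (ttgt_to X k m (tsrc X m u))) (tsrc X m u))"
        using s k teq_Idt_pow[of X k] by (intro teq_Cmp) (auto simp: composable_def tsrc_to_Idt_pow)
      then have "teq X m (Cmp k ((Idt ^^ (m - k)) ?a) (tsrc X m u)) (tsrc X m u)"
        using teq.teq_unit_left[OF k s(1)] teq.teq_trans by blast
      moreover have "teq X m (Cmp k ((Idt ^^ (m - k)) ?a) (ttgt X m u)) (ttgt X m u)"
        unfolding e using teq.teq_unit_left[OF k s(2)] .
      ultimately show ?thesis using k m by (simp add: Suc_diff_le)
    qed
  qed
  moreover have "bd_glob X n (Cmp k ((Idt ^^ (n - k)) ?a) u)"
    using IH teq_unit_left.hyps(1) c bd_Idt_pow[OF low a]
    by (auto intro!: bd_glob_Cmp[OF low])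
  ultimately show ?case using IH by blast
next
  case (teq_unit_right k n u)
  note low = teq_unit_right.prems and IH = teq_unit_right.IH(1)[OF low]
  let ?a = "tsrc_to X k n u"
  have a: "teq X k ?a ?a" using low_iter_cong[OF low _ teq_unit_right.hyps(1)] IH by blast
  have c: "composable X k n u ((Idt ^^ (n - k)) ?a)"
    using a teq_unit_right.hyps by (simp add: composable_def ttgt_to_Idt_pow)
  have "bd_cong X n (Cmp k u ((Idt ^^ (n - k)) ?a)) u"
    unfolding bd_cong_def
  proof (intro allI impI)
    fix m assume m: "n = Suc m"
    show "teq X m (tsrc X m (Cmp k u ((Idt ^^ (n - k)) ?a))) (tsrc X m u) \<and>
      teq X m (ttgt X m (Cmp k u ((Idt ^^ (n - k)) ?a))) (ttgt X m u)"
    proof (cases "k = m")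
      case True
      then show ?thesis using IH m bd_congD[of X m] by auto
    next
      case False
      then have k: "k < m" using m teq_unit_right.hyps(1) by simp
      have s: "teq X m (tsrc X m u) (tsrc X m u)" "teq X m (ttgt X m u) (ttgt X m u)"
        using IH m bd_congD[of X m] by auto
      have e: "?a = tsrc_to X k m (tsrc X m u)" using m k by simp
      \<comment> \<open>The mirror image: now the target of \<open>u\<close> is the side on which
        the unit has to be replaced.\<close>
      have "teq X k (tsrc_to X k m (ttgt X m u)) ?a"
        unfolding e using low_iter_glob[OF low, of m u k] IH m k teq.teq_sym by blast
      then have "teq X m (Cmp k (ttgt X m u) ((Idt ^^ (m - k)) (tsrc_to X k m (ttgt X m u))))
        (Cmp k (ttgt X m u) ((Idt ^^ (m - k)) ?a))"
        using s k teq_Idt_pow[of X k] teq_refl_left[of X k]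
        by (intro teq_Cmp) (auto simp: composable_def ttgt_to_Idt_pow)
      then have "teq X m (Cmp k (ttgt X m u) ((Idt ^^ (m - k)) ?a)) (ttgt X m u)"
        using teq.teq_unit_right[OF k s(2)] teq.teq_trans teq.teq_sym by blast
      moreover have "teq X m (Cmp k (tsrc X m u) ((Idt ^^ (m - k)) ?a)) (tsrc X m u)"
        unfolding e using teq.teq_unit_right[OF k s(1)] .
      ultimately show ?thesis using k m by (simp add: Suc_diff_le)
    qed
  qed
  moreover have "bd_glob X n (Cmp k u ((Idt ^^ (n - k)) ?a))"
    using IH teq_unit_right.hyps(1) c bd_Idt_pow[OF low a]
    by (auto intro!: bd_glob_Cmp[OF low])
  ultimately show ?case using IH by blast
next
  case (teq_interchange j k n u v u' v')
  note low = teq_interchange.prems and IH = teq_interchange.IH(1-4)[OF low]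
    and jk = teq_interchange.hyps(1,2)
  have c: "composable X k n u v" "composable X k n u' v'" "composable X j n u u'"
    "composable X j n v v'"
    using teq_interchange.hyps by (simp_all add: composable_def)
  have ci: "composable X j n (Cmp k u v) (Cmp k u' v')" "composable X k n (Cmp j u u') (Cmp j v v')"
    using composable_interchange[OF low jk _ _ _ _ _ _ _ _ c] IH by blast+
  have "bd_cong X n (Cmp j (Cmp k u v) (Cmp k u' v')) (Cmp k (Cmp j u u') (Cmp j v v'))"
    unfolding bd_cong_def
  proof (intro allI impI)
    fix m assume m: "n = Suc m"
    have j: "j < m" using jk m by simp
    note cb = composable_bd[OF low _, of m, folded m, OF order_refl]
    show "teq X m (tsrc X m (Cmp j (Cmp k u v) (Cmp k u' v')))
        (tsrc X m (Cmp k (Cmp j u u') (Cmp j v v'))) \<and>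
      teq X m (ttgt X m (Cmp j (Cmp k u v) (Cmp k u' v')))
        (ttgt X m (Cmp k (Cmp j u u') (Cmp j v v')))"
    proof (cases "k = m")
      case True
      \<comment> \<open>When the boundary step removes the composition along \<open>k\<close>, both
        sides become the same term, a composite along \<open>j\<close>; it only has to be
        well-formed.\<close>
      have "composable X j m (tsrc X m v) (tsrc X m v')" "composable X j m (ttgt X m u) (ttgt X m u')"
        using cb[OF j] IH c by blast+
      moreover have "teq X m (tsrc X m w) (tsrc X m w) \<and> teq X m (ttgt X m w) (ttgt X m w)"
        if "w = u \<or> w = v \<or> w = u' \<or> w = v'" for w
        using that IH m bd_congD[of X m] by blast
      ultimately show ?thesis using True j by (simp add: teq_Cmp)
    next
      case False
      then have k: "k < m" using m jk by simp
      have "composable X k m (tsrc X m u) (tsrc X m v)" "composable X k m (tsrc X m u') (tsrc X m v')"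
        "composable X k m (ttgt X m u) (ttgt X m v)" "composable X k m (ttgt X m u') (ttgt X m v')"
        "composable X j m (tsrc X m u) (tsrc X m u')" "composable X j m (tsrc X m v) (tsrc X m v')"
        "composable X j m (ttgt X m u) (ttgt X m u')" "composable X j m (ttgt X m v) (ttgt X m v')"
        using cb[OF k] cb[OF j] IH c by blast+
      moreover have "teq X m (tsrc X m w) (tsrc X m w) \<and> teq X m (ttgt X m w) (ttgt X m w)"
        if "w = u \<or> w = v \<or> w = u' \<or> w = v'" for w
        using that IH m bd_congD[of X m] by blast
      ultimately show ?thesis using False j jk(1) k teq.teq_interchange[OF jk(1) k, of X]
        by (simp add: composable_def)
    qed
  qed
  moreover have "bd_glob X n (Cmp j (Cmp k u v) (Cmp k u' v'))"
    "bd_glob X n (Cmp k (Cmp j u u') (Cmp j v v'))"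
    using IH jk c ci by (intro bd_glob_Cmp[OF low] bd_cong_Cmp[OF low]; blast intro: less_trans)+
  ultimately show ?case by blast
next
  case (teq_idt_cmp k n u v)
  note low = teq_idt_cmp.prems
  have c: "composable X k n u v" using teq_idt_cmp.hyps by (simp add: composable_def)
  then have c': "composable X k (Suc n) (Idt u) (Idt v)"
    using teq_idt_cmp.hyps(1) by (simp add: composable_def)
  have uv: "teq X n (Cmp k u v) (Cmp k u v)" using teq_idt_cmp.hyps c by (blast intro: teq_Cmp)
  have "bd_glob X (Suc n) (Idt (Cmp k u v))" using bd_glob_Idt[OF low] uv by simp
  moreover have "bd_glob X (Suc n) (Cmp k (Idt u) (Idt v))"
    using bd_glob_Cmp[OF low _ _ _ _ _ c'] teq_idt_cmp.hyps(1-3) bd_glob_Idt[OF low]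
      bd_cong_Idt[of X n] less_SucI by blast
  moreover have "bd_cong X (Suc n) (Idt (Cmp k u v)) (Cmp k (Idt u) (Idt v))"
    using uv teq_idt_cmp.hyps(1) by (simp add: bd_cong_def)
  ultimately show ?case by blast
qed

text \<open>The outer induction: \<open>bd_below X 0\<close> is vacuous, and
  \<open>teq_bd_step\<close> in dimension \<open>n\<close> is what carries \<open>bd_below\<close>
  from \<open>n\<close> to \<open>n + 1\<close>.\<close>

lemma teq_bd:
  assumes "globular_set X" "teq X n u v"
  shows "bd_cong X n u v \<and> bd_glob X n u \<and> bd_glob X n v"
proof -
  have "bd_below X n"
  proof (induction n)
    case (Suc n)
    then show ?case unfolding bd_below_def less_Suc_eq
      using teq_bd_step[OF assms(1) _ Suc] by blast
  qed (simp add: bd_below_def)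
  then show ?thesis using teq_bd_step assms by blast
qed

section \<open>The monad\<close>

lemma teq_tsrc:
  assumes "globular_set X" "teq X (Suc n) u v"
  shows "teq X n (tsrc X n u) (tsrc X n v)" "teq X n (ttgt X n u) (ttgt X n v)"
  using teq_bd[OF assms] bd_congD by blast+

lemma teq_globular:
  assumes "globular_set X" "teq X (Suc (Suc n)) u u"
  shows "teq X n (tsrc X n (tsrc X (Suc n) u)) (tsrc X n (ttgt X (Suc n) u))"
    "teq X n (ttgt X n (tsrc X (Suc n) u)) (ttgt X n (ttgt X (Suc n) u))"
  using teq_bd[OF assms] bd_globD by blast+

lemma globular_bd_below: "globular_set X \<Longrightarrow> bd_below X n"
  using teq_bd by (auto simp: bd_below_def)

lemma teq_tsrc_to:
  assumes "globular_set X" "teq X n u v" "k \<le> n"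
  shows "teq X k (tsrc_to X k n u) (tsrc_to X k n v)" "teq X k (ttgt_to X k n u) (ttgt_to X k n v)"
  using low_iter[OF globular_bd_below[OF assms(1), of "Suc n"], of n k u v] assms by auto

lemma composable_cong:
  assumes "globular_set X" "teq X n u u'" "teq X n v v'" "k \<le> n" "composable X k n u v"
  shows "composable X k n u' v'"
  using assms(5) teq_tsrc_to[OF assms(1,2,4)] teq_tsrc_to[OF assms(1,3,4)]
  unfolding composable_def by (meson teq_sym teq_trans)

text \<open>A derivation of \<open>teq X n t t\<close> may pass through other terms by transitivity,
  so it cannot be inverted along the shape of \<open>t\<close>. This recursive version of
  well-formedness can, and it supports induction on terms; over a globular set the two
  agree.\<close>

primrec twf :: "('a, 'z) glob_scheme \<Rightarrow> 'a gterm \<Rightarrow> nat \<Rightarrow> bool" where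
  "twf X (Gen x) n \<longleftrightarrow> x \<in> cells X n"
| "twf X (Idt u) n \<longleftrightarrow> (\<exists>m. n = Suc m \<and> twf X u m)"
| "twf X (Cmp k u v) n \<longleftrightarrow> k < n \<and> twf X u n \<and> twf X v n \<and> composable X k n u v"

lemma twf_teq: "twf X t n \<Longrightarrow> teq X n t t"
  by (induction t arbitrary: n) (auto intro: teq_gen teq_idt teq_Cmp)

lemma twf_tsrc:
  assumes "globular_set X"
  shows "twf X t (Suc n) \<Longrightarrow> twf X (tsrc X n t) n \<and> twf X (ttgt X n t) n"
proof (induction t)
  case (Gen x)
  then show ?case using assms by (simp add: globular_set_def)
next
  case (Cmp k u v)
  show ?case
  proof (cases "k = n")
    case False
    then have k: "k < n" using Cmp.prems by simp
    have g: "bd_glob X (Suc n) u" "bd_glob X (Suc n) v"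
      using Cmp.prems twf_teq teq_bd[OF assms] by (meson twf.simps)+
    note c = composable_bd[OF globular_bd_below[OF assms] order_refl k g]
    show ?thesis using Cmp k c by auto
  qed (use Cmp in auto)
qed auto

lemma twf_tsrc_to:
  assumes "globular_set X" "k \<le> n" "twf X t n"
  shows "twf X (tsrc_to X k n t) k" "twf X (ttgt_to X k n t) k"
proof -
  have "twf X (tsrc_to X k n t) k \<and> twf X (ttgt_to X k n t) k" if "k \<le> n" "twf X t n" for t
    using that
  proof (induction n arbitrary: t)
    case (Suc n)
    then show ?case using twf_tsrc[OF assms(1)] by (cases "k = Suc n") auto
  qed simp
  then show "twf X (tsrc_to X k n t) k" "twf X (ttgt_to X k n t) k" using assms by auto
qed

lemma twf_Idt_pow: "k \<le> n \<Longrightarrow> twf X u k \<Longrightarrow> twf X ((Idt ^^ (n - k)) u) n"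
  by (induction n) (auto simp: le_Suc_eq Suc_diff_le)

text \<open>Both sides of every rule are inspected. The work lies in composability conditions that
  the rules leave implicit: the right-hand composite of a congruence, the units in the unit laws,
  and the composites of composites in interchange.\<close>

lemma teq_twf_both:
  assumes "globular_set X" "teq X n t u"
  shows "twf X t n \<and> twf X u n"
  using assms(2)
proof (induction rule: teq.induct)
  case (teq_cmp k n u u' v v')
  then show ?case using composable_cong[OF assms(1) teq_cmp.hyps(2,3)]
    by (simp add: composable_def)
next
  case (teq_unit_left k n u)
  then have "twf X (ttgt_to X k n u) k" using twf_tsrc_to[OF assms(1)] by simp
  then show ?case using teq_unit_left twf_Idt_pow[of k n X] twf_teq[of X _ k]
    by (simp add: composable_def tsrc_to_Idt_pow)
next
  case (teq_unit_right k n u)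
  then have "twf X (tsrc_to X k n u) k" using twf_tsrc_to[OF assms(1)] by simp
  then show ?case using teq_unit_right twf_Idt_pow[of k n X] twf_teq[of X _ k]
    by (simp add: composable_def ttgt_to_Idt_pow)
next
  case (teq_interchange j k n u v u' v')
  have c: "composable X k n u v" "composable X k n u' v'" "composable X j n u u'"
    "composable X j n v v'"
    using teq_interchange.hyps by (simp_all add: composable_def)
  have "composable X j n (Cmp k u v) (Cmp k u' v')" "composable X k n (Cmp j u u') (Cmp j v v')"
    using composable_interchange[OF globular_bd_below[OF assms(1)] teq_interchange.hyps(1,2)
        _ _ _ _ _ _ _ _ c] teq_interchange.hyps(3-6) teq_bd[OF assms(1)] by blast+
  then show ?case using teq_interchange.IH c teq_interchange.hyps(1,2) by simp
qed (auto simp: composable_def tsrc_to_Cmp ttgt_to_Cmp)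

lemma teq_twf: "globular_set X \<Longrightarrow> teq X n t t \<longleftrightarrow> twf X t n"
  using teq_twf_both twf_teq by blast

section \<open>Cells of the free category as classes of terms\<close>

lemma tclass_eq: "teq X n t u \<Longrightarrow> tclass X n t = tclass X n u"
  unfolding tclass_def by (intro Collect_cong) (meson teq_sym teq_trans)

text \<open>The form in which boundaries, \<open>free_map\<close> and \<open>free_mult\<close> are
  defined on classes: once the value is constant on the class, the union collapses to its value at
  any chosen term.\<close>

lemma UN_tclass:
  "teq X n t t \<Longrightarrow> (\<And>u. teq X n t u \<Longrightarrow> g u = g t) \<Longrightarrow> (\<Union>u\<in>tclass X n t. g u) = g t"
  unfolding tclass_def by blast

lemma cells_free: "c \<in> cells (free X) n \<longleftrightarrow> (\<exists>t. c = tclass X n t \<and> teq X n t t)"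
  by (auto simp: free_def)

lemma tclass_in_free [intro]: "teq X n t t \<Longrightarrow> tclass X n t \<in> cells (free X) n"
  by (auto simp: cells_free)

lemma cells_freeE:
  assumes "c \<in> cells (free X) n"
  obtains t where "c = tclass X n t" "teq X n t t"
  using assms by (auto simp: cells_free)

lemma some_in_class:
  assumes "c \<in> cells (free X) n"
  shows "teq X n (SOME t. t \<in> c) (SOME t. t \<in> c)" "tclass X n (SOME t. t \<in> c) = c"
proof -
  obtain t where t: "c = tclass X n t" "teq X n t t" using assms by (rule cells_freeE)
  then have "t \<in> c" by (simp add: tclass_def)
  then have "(SOME t. t \<in> c) \<in> c" by (rule someI)
  then have "teq X n t (SOME t. t \<in> c)" using t by (simp add: tclass_def)
  then show "teq X n (SOME t. t \<in> c) (SOME t. t \<in> c)" "tclass X n (SOME t. t \<in> c) = c"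
    using t tclass_eq teq_refl_right by blast+
qed

lemma some_in_tclass: "teq X n t t \<Longrightarrow> teq X n (SOME u. u \<in> tclass X n t) t"
  unfolding tclass_def mem_Collect_eq by (rule teq_sym) (rule someI)

lemma gsrc_free:
  assumes "globular_set X" "teq X (Suc n) t t"
  shows "gsrc (free X) n (tclass X (Suc n) t) = tclass X n (tsrc X n t)"
    "gtgt (free X) n (tclass X (Suc n) t) = tclass X n (ttgt X n t)"
proof -
  have "(\<Union>u\<in>tclass X (Suc n) t. tclass X n (tsrc X n u)) = tclass X n (tsrc X n t)"
    "(\<Union>u\<in>tclass X (Suc n) t. tclass X n (ttgt X n u)) = tclass X n (ttgt X n t)"
    by (rule UN_tclass[OF assms(2)], rule tclass_eq, rule teq_sym, erule teq_tsrc[OF assms(1)])+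
  then show "gsrc (free X) n (tclass X (Suc n) t) = tclass X n (tsrc X n t)"
    "gtgt (free X) n (tclass X (Suc n) t) = tclass X n (ttgt X n t)"
    by (simp_all add: free_def)
qed

lemma globular_free:
  assumes X: "globular_set X"
  shows "globular_set (free X)"
  unfolding globular_set_def
proof (intro conjI allI ballI)
  fix k c assume "c \<in> cells (free X) (Suc k)"
  then obtain t where t: "c = tclass X (Suc k) t" "teq X (Suc k) t t" by (rule cells_freeE)
  then show "gsrc (free X) k c \<in> cells (free X) k" "gtgt (free X) k c \<in> cells (free X) k"
    using teq_tsrc[OF X t(2)] X by (auto simp: gsrc_free)
next
  fix k c assume "c \<in> cells (free X) (Suc (Suc k))"
  then obtain t where t: "c = tclass X (Suc (Suc k)) t" "teq X (Suc (Suc k)) t t" by (rule cells_freeE)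
  then show "gsrc (free X) k (gsrc (free X) (Suc k) c) = gsrc (free X) k (gtgt (free X) (Suc k) c)"
    "gtgt (free X) k (gsrc (free X) (Suc k) c) = gtgt (free X) k (gtgt (free X) (Suc k) c)"
    using tclass_eq[OF teq_globular(1)[OF X t(2)]] tclass_eq[OF teq_globular(2)[OF X t(2)]]
      teq_tsrc[OF X t(2)] t X by (simp_all add: gsrc_free)
qed

subsection \<open>Functoriality\<close>

lemma globular_mapD:
  "globular_map X Y f \<Longrightarrow> x \<in> cells X k \<Longrightarrow> f k x \<in> cells Y k"
  "globular_map X Y f \<Longrightarrow> x \<in> cells X (Suc k) \<Longrightarrow> f k (gsrc X k x) = gsrc Y k (f (Suc k) x)"
  "globular_map X Y f \<Longrightarrow> x \<in> cells X (Suc k) \<Longrightarrow> f k (gtgt X k x) = gtgt Y k (f (Suc k) x)"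
  by (auto simp: globular_map_def)

text \<open>Here boundaries are preserved on the nose, as equal terms. Well-formedness is assumed
  because \<open>f\<close> commutes with boundaries only on the carriers.\<close>

lemma tmap_tsrc:
  assumes "globular_map X Y f"
  shows "twf X t (Suc n) \<Longrightarrow> tsrc Y n (tmap f t (Suc n)) = tmap f (tsrc X n t) n \<and>
    ttgt Y n (tmap f t (Suc n)) = tmap f (ttgt X n t) n"
  using globular_mapD[OF assms] by (induction t) auto

lemma tmap_tsrc_to:
  assumes "globular_set X" "globular_map X Y f" "k \<le> n" "twf X t n"
  shows "tsrc_to Y k n (tmap f t n) = tmap f (tsrc_to X k n t) k"
    "ttgt_to Y k n (tmap f t n) = tmap f (ttgt_to X k n t) k"
proof -
  have "tsrc_to Y k n (tmap f t n) = tmap f (tsrc_to X k n t) k \<and>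
    ttgt_to Y k n (tmap f t n) = tmap f (ttgt_to X k n t) k" if "k \<le> n" "twf X t n" for t
    using that
  proof (induction n arbitrary: t)
    case (Suc n)
    then show ?case using twf_tsrc[OF assms(1)] tmap_tsrc[OF assms(2)] by (cases "k = Suc n") auto
  qed simp
  then show "tsrc_to Y k n (tmap f t n) = tmap f (tsrc_to X k n t) k"
    "ttgt_to Y k n (tmap f t n) = tmap f (ttgt_to X k n t) k" using assms by auto
qed

lemma tmap_Idt_pow: "k \<le> n \<Longrightarrow> tmap f ((Idt ^^ (n - k)) u) n = (Idt ^^ (n - k)) (tmap f u k)"
  by (induction n) (auto simp: le_Suc_eq Suc_diff_le)

lemma tmap_teq:
  assumes X: "globular_set X" and f: "globular_map X Y f" and "teq X n t u"
  shows "teq Y n (tmap f t n) (tmap f u n)"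
  using assms(3)
proof (induction rule: teq.induct)
  case (teq_gen x n)
  then show ?case using f by (simp add: globular_map_def teq.teq_gen)
next
  case (teq_idt n u u')
  then show ?case by (simp add: teq.teq_idt)
next
  case (teq_cmp k n u u' v v')
  then have "twf X u n" "twf X v n" using teq_twf_both[OF X] by auto
  then show ?case using teq_cmp by (simp add: teq.teq_cmp tmap_tsrc_to[OF X f])
next
  case (teq_sym n u v)
  then show ?case using teq.teq_sym by blast
next
  case (teq_trans n u v w)
  then show ?case using teq.teq_trans by blast
next
  case (teq_assoc k n u v w)
  then have "twf X u n" "twf X v n" "twf X w n" using teq_twf_both[OF X] by auto
  then show ?case using teq_assoc by (simp add: teq.teq_assoc tmap_tsrc_to[OF X f])
next
  case (teq_unit_left k n u)
  then have "twf X u n" using teq_twf[OF X] by auto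
  then show ?case using teq_unit_left teq.teq_unit_left[OF teq_unit_left.hyps(1), of Y "tmap f u n"]
    by (simp add: tmap_Idt_pow tmap_tsrc_to[OF X f])
next
  case (teq_unit_right k n u)
  then have "twf X u n" using teq_twf[OF X] by auto
  then show ?case
    using teq_unit_right teq.teq_unit_right[OF teq_unit_right.hyps(1), of Y "tmap f u n"]
    by (simp add: tmap_Idt_pow tmap_tsrc_to[OF X f])
next
  case (teq_interchange j k n u v u' v')
  then have "twf X u n" "twf X v n" "twf X u' n" "twf X v' n" using teq_twf[OF X] by auto
  then show ?case using teq_interchange by (simp add: teq.teq_interchange tmap_tsrc_to[OF X f])
next
  case (teq_idt_cmp k n u v)
  then have "twf X u n" "twf X v n" using teq_twf[OF X] by auto
  then show ?case using teq_idt_cmp by (simp add: teq.teq_idt_cmp tmap_tsrc_to[OF X f])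
qed

lemma tmap_tmap: "tmap f (tmap g t n) n = tmap (f \<odot> g) t n"
  by (induction t arbitrary: n) (auto simp: map_comp_glob_def)

lemma tmap_id: "tmap id_map t n = t"
  by (induction t arbitrary: n) (auto simp: id_map_def)

lemma tmap_cong: "map_eq X f g \<Longrightarrow> twf X t n \<Longrightarrow> tmap f t n = tmap g t n"
  by (induction t arbitrary: n) (auto simp: map_eq_def)

lemma free_map_tclass:
  assumes "globular_set X" "globular_map X Y f" "teq X n t t"
  shows "free_map Y f n (tclass X n t) = tclass Y n (tmap f t n)"
  unfolding free_map_def
  by (rule UN_tclass[OF assms(3)], rule tclass_eq, rule teq_sym, erule tmap_teq[OF assms(1,2)])

lemma free_map_globular:
  assumes "globular_set X" "globular_set Y" "globular_map X Y f"
  shows "globular_map (free X) (free Y) (free_map Y f)"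
  unfolding globular_map_def
proof (intro conjI allI ballI)
  fix k c assume "c \<in> cells (free X) k"
  then show "free_map Y f k c \<in> cells (free Y) k"
    using assms by (auto simp: free_map_tclass intro!: tclass_in_free tmap_teq[OF assms(1,3)]
        elim!: cells_freeE)
next
  fix k c assume "c \<in> cells (free X) (Suc k)"
  then obtain t where t: "c = tclass X (Suc k) t" "teq X (Suc k) t t" by (rule cells_freeE)
  then show "free_map Y f k (gsrc (free X) k c) = gsrc (free Y) k (free_map Y f (Suc k) c)"
    "free_map Y f k (gtgt (free X) k c) = gtgt (free Y) k (free_map Y f (Suc k) c)"
    using assms teq_tsrc[OF assms(1) t(2)] tmap_teq[OF assms(1,3) t(2)]
      tmap_tsrc[OF assms(3), of t k] teq_twf[OF assms(1), of "Suc k" t]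
    by (simp_all add: gsrc_free free_map_tclass)
qed

lemma free_map_comp:
  assumes "globular_set X" "globular_set Y" "globular_map X Y g" "globular_map Y Z f"
    and "c \<in> cells (free X) n"
  shows "free_map Z f n (free_map Y g n c) = free_map Z (f \<odot> g) n c"
proof -
  have "globular_map X Z (f \<odot> g)"
    using assms by (auto simp: globular_map_def map_comp_glob_def)
  moreover obtain t where t: "c = tclass X n t" "teq X n t t" using assms(5) by (rule cells_freeE)
  ultimately show ?thesis using assms(1-4) tmap_teq[OF assms(1,3) t(2)]
    by (simp add: free_map_tclass tmap_tmap)
qed

lemma free_map_id: "globular_set X \<Longrightarrow> c \<in> cells (free X) n \<Longrightarrow> free_map X id_map n c = c"
  using free_map_tclass[of X X id_map]
  by (auto simp: tmap_id elim!: cells_freeE) (auto simp: globular_map_def id_map_def)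

lemma free_map_cong:
  assumes "globular_set X" "map_eq X f g" "c \<in> cells (free X) n"
  shows "free_map Y f n c = free_map Y g n c"
proof -
  have "twf X t n" if "t \<in> c" for t
    using that assms(3) teq_twf_both[OF assms(1)] by (auto simp: cells_free tclass_def)
  then show ?thesis using tmap_cong[OF assms(2)] by (simp add: free_map_def)
qed

subsection \<open>Unit and multiplication\<close>

lemma free_unit_globular: "globular_set X \<Longrightarrow> globular_map X (free X) (free_unit X)"
  by (auto simp: globular_map_def free_unit_def gsrc_free teq_gen)

lemma free_unit_natural:
  "globular_set X \<Longrightarrow> globular_map X Y f \<Longrightarrow> x \<in> cells X n \<Longrightarrow>
    free_map Y f n (free_unit X n x) = free_unit Y n (f n x)"
  by (simp add: free_unit_def free_map_tclass teq_gen)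

text \<open>Only \<open>teq\<close> can be expected: the representative chosen for a source class
  need not be the source of the chosen representative. That the flattened term is well-formed is a
  hypothesis, since \<open>tflat_teq\<close>, which provides it, is derived from this lemma.\<close>

lemma tflat_tsrc:
  assumes X: "globular_set X"
  shows "twf (free X) t (Suc n) \<Longrightarrow> teq X (Suc n) (tflat t) (tflat t) \<Longrightarrow>
    teq X n (tsrc X n (tflat t)) (tflat (tsrc (free X) n t)) \<and>
    teq X n (ttgt X n (tflat t)) (tflat (ttgt (free X) n t))"
proof (induction t)
  case (Gen c)
  let ?s = "SOME t. t \<in> c"
  have c: "teq X (Suc n) ?s ?s" "tclass X (Suc n) ?s = c" using Gen some_in_class[of c X] by auto
  then have "gsrc (free X) n c = tclass X n (tsrc X n ?s)"
    "gtgt (free X) n c = tclass X n (ttgt X n ?s)"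
    using gsrc_free[OF X c(1)] by auto
  then show ?case using teq_tsrc[OF X c(1)] some_in_tclass teq_sym by simp blast
next
  case (Idt u)
  then show ?case using teq_tsrc[OF X Idt.prems(2)] by simp
next
  case (Cmp k u v)
  have w: "twf X (Cmp k (tflat u) (tflat v)) (Suc n)" using Cmp.prems teq_twf[OF X] by auto
  then have r: "teq X (Suc n) (tflat u) (tflat u)" "teq X (Suc n) (tflat v) (tflat v)"
    using twf_teq by (meson twf.simps)+
  show ?case
  proof (cases "k = n")
    case False
    then have k: "k < n" using Cmp.prems by simp
    have "composable X k n (tsrc X n (tflat u)) (tsrc X n (tflat v))"
      "composable X k n (ttgt X n (tflat u)) (ttgt X n (tflat v))"
      using twf_tsrc[OF X w] k by auto
    then show ?thesis using Cmp r k by (auto intro!: teq_Cmp)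
  qed (use Cmp r in auto)
qed

lemma tflat_tsrc_to:
  assumes X: "globular_set X" and "k \<le> n" "twf (free X) t n" "teq X n (tflat t) (tflat t)"
  shows "teq X k (tsrc_to X k n (tflat t)) (tflat (tsrc_to (free X) k n t))"
    "teq X k (ttgt_to X k n (tflat t)) (tflat (ttgt_to (free X) k n t))"
proof -
  have "teq X k (tsrc_to X k n (tflat t)) (tflat (tsrc_to (free X) k n t)) \<and>
    teq X k (ttgt_to X k n (tflat t)) (tflat (ttgt_to (free X) k n t))"
    if "k \<le> n" "twf (free X) t n" "teq X n (tflat t) (tflat t)" for t
    using that
  proof (induction n arbitrary: t)
    case (Suc n)
    show ?case
    proof (cases "k = Suc n")
      case False
      then have k: "k \<le> n" using Suc.prems by simp
      have w: "twf (free X) (tsrc (free X) n t) n" "twf (free X) (ttgt (free X) n t) n"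
        using twf_tsrc[OF globular_free[OF X] Suc.prems(2)] by auto
      have s: "teq X n (tsrc X n (tflat t)) (tflat (tsrc (free X) n t))"
        "teq X n (ttgt X n (tflat t)) (tflat (ttgt (free X) n t))"
        using tflat_tsrc[OF X Suc.prems(2,3)] by auto
      show ?thesis
        using Suc.IH[OF k w(1)] Suc.IH[OF k w(2)] k
          teq_tsrc_to(1)[OF X s(1) k] teq_tsrc_to(2)[OF X s(2) k]
          teq_refl_right[OF s(1)] teq_refl_right[OF s(2)] teq_trans
        by simp blast
    qed (use Suc.prems in auto)
  qed simp
  then show "teq X k (tsrc_to X k n (tflat t)) (tflat (tsrc_to (free X) k n t))"
    "teq X k (ttgt_to X k n (tflat t)) (tflat (ttgt_to (free X) k n t))" using assms by auto
qed

lemma tflat_Idt_pow: "tflat ((Idt ^^ m) u) = (Idt ^^ m) (tflat u)"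
  by (induction m) auto

text \<open>In the induction for \<open>tflat_teq\<close> the hypothesis on a lower boundary
  concerns flattened boundaries, while composability is about boundaries of flattened terms.
  \<open>tflat_tsrc_to\<close> bridges the two.\<close>

lemma tflat_composable:
  assumes "globular_set X" "k < n" "teq (free X) n u u" "teq (free X) n v v"
    and "teq X n (tflat u) (tflat u)" "teq X n (tflat v) (tflat v)"
    and "teq X k (tflat (tsrc_to (free X) k n u)) (tflat (ttgt_to (free X) k n v))"
  shows "composable X k n (tflat u) (tflat v)"
  using tflat_tsrc_to[OF assms(1), of k n u] tflat_tsrc_to[OF assms(1), of k n v] assms
    teq_twf[OF globular_free[OF assms(1)]]
  unfolding composable_def by (meson less_imp_le teq_sym teq_trans)

lemma tflat_teq:
  assumes X: "globular_set X" and "teq (free X) n t u"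
  shows "teq X n (tflat t) (tflat u)"
  using assms(2)
proof (induction rule: teq.induct)
  case (teq_gen c n)
  then show ?case using some_in_class by simp
next
  case (teq_idt n u u')
  then show ?case by (simp add: teq.teq_idt)
next
  case (teq_cmp k n u u' v v')
  have "composable X k n (tflat u) (tflat v)"
    using tflat_composable[OF X teq_cmp.hyps(1) teq_refl_left[OF teq_cmp.hyps(2)]
        teq_refl_left[OF teq_cmp.hyps(3)] teq_refl_left[OF teq_cmp.IH(1)]
        teq_refl_left[OF teq_cmp.IH(2)] teq_cmp.IH(3)] .
  then show ?case using teq_cmp.hyps(1) teq_cmp.IH(1,2) by (simp add: teq_Cmp)
next
  case (teq_sym n u v)
  then show ?case using teq.teq_sym by blast
next
  case (teq_trans n u v w)
  then show ?case using teq.teq_trans by blast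
next
  case (teq_assoc k n u v w)
  then have "composable X k n (tflat u) (tflat v)" "composable X k n (tflat v) (tflat w)"
    using tflat_composable[OF X teq_assoc.hyps(1)] by blast+
  then show ?case using teq_assoc by (simp add: teq.teq_assoc composable_def)
next
  case (teq_unit_left k n u)
  let ?a = "tflat (ttgt_to (free X) k n u)"
  have k: "k \<le> n" and w: "twf (free X) u n"
    using teq_unit_left.hyps teq_twf[OF globular_free[OF X]] by auto
  \<comment> \<open>The flattened unit is built on chosen representatives of the
    \<open>k\<close>-target and must first be replaced by the unit on the \<open>k\<close>-target of
    the flattened term.\<close>
  have a: "teq X k ?a (ttgt_to X k n (tflat u))"
    using tflat_tsrc_to(2)[OF X k w teq_unit_left.IH] teq.teq_sym by blast
  have "teq X n (Cmp k ((Idt ^^ (n - k)) ?a) (tflat u))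
    (Cmp k ((Idt ^^ (n - k)) (ttgt_to X k n (tflat u))) (tflat u))"
    using teq_unit_left a k teq_Idt_pow[of X k]
    by (intro teq_Cmp) (auto simp: composable_def tsrc_to_Idt_pow)
  then show ?case
    using teq.teq_unit_left[OF teq_unit_left.hyps(1) teq_unit_left.IH] teq.teq_trans
    by (simp add: tflat_Idt_pow) blast
next
  case (teq_unit_right k n u)
  let ?a = "tflat (tsrc_to (free X) k n u)"
  have k: "k \<le> n" and w: "twf (free X) u n"
    using teq_unit_right.hyps teq_twf[OF globular_free[OF X]] by auto
  have a: "teq X k (tsrc_to X k n (tflat u)) ?a"
    using tflat_tsrc_to(1)[OF X k w teq_unit_right.IH] by blast
  have "teq X n (Cmp k (tflat u) ((Idt ^^ (n - k)) ?a))
    (Cmp k (tflat u) ((Idt ^^ (n - k)) (tsrc_to X k n (tflat u))))"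
    using teq_unit_right a k teq_Idt_pow[OF teq.teq_sym[OF a]]
    by (intro teq_Cmp) (auto simp: composable_def ttgt_to_Idt_pow)
  then show ?case
    using teq.teq_unit_right[OF teq_unit_right.hyps(1) teq_unit_right.IH] teq.teq_trans
    by (simp add: tflat_Idt_pow) blast
next
  case (teq_interchange j k n u v u' v')
  have j: "j < n" using teq_interchange.hyps by simp
  note ck = tflat_composable[OF X teq_interchange.hyps(2)]
    and cj = tflat_composable[OF X j]
  have "composable X k n (tflat u) (tflat v)" "composable X k n (tflat u') (tflat v')"
    "composable X j n (tflat u) (tflat u')" "composable X j n (tflat v) (tflat v')"
    using ck[OF teq_interchange.hyps(3,4)] ck[OF teq_interchange.hyps(5,6)]
      cj[OF teq_interchange.hyps(3,5)] cj[OF teq_interchange.hyps(4,6)] teq_interchange.IH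
    by blast+
  then show ?case using teq_interchange.hyps(1,2) teq_interchange.IH(1-4)
    by (simp add: teq.teq_interchange composable_def)
next
  case (teq_idt_cmp k n u v)
  then have "composable X k n (tflat u) (tflat v)"
    using tflat_composable[OF X teq_idt_cmp.hyps(1)] by blast
  then show ?case using teq_idt_cmp by (simp add: teq.teq_idt_cmp composable_def)
qed

lemma free_mult_tclass:
  assumes "globular_set X" "teq (free X) n t t"
  shows "free_mult X n (tclass (free X) n t) = tclass X n (tflat t)"
  unfolding free_mult_def
  by (rule UN_tclass[OF assms(2)], rule tclass_eq, rule teq_sym, erule tflat_teq[OF assms(1)])

lemma free_mult_globular:
  assumes "globular_set X"
  shows "globular_map (free (free X)) (free X) (free_mult X)"
  unfolding globular_map_def
proof (intro conjI allI ballI)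
  fix k c
  assume "c \<in> cells (free (free X)) k"
  then show "free_mult X k c \<in> cells (free X) k"
    using assms by (auto simp: free_mult_tclass intro!: tclass_in_free tflat_teq elim!: cells_freeE)
next
  fix k c
  assume "c \<in> cells (free (free X)) (Suc k)"
  then obtain t where t: "c = tclass (free X) (Suc k) t" "teq (free X) (Suc k) t t" by (rule cells_freeE)
  have X': "globular_set (free X)" using assms by (rule globular_free)
  note f = tflat_teq[OF assms t(2)] and s = teq_tsrc[OF X' t(2)]
  have "twf (free X) t (Suc k)" using teq_twf[OF X'] t(2) by blast
  note e = tflat_tsrc[OF assms this f]
  show "free_mult X k (gsrc (free (free X)) k c) = gsrc (free X) k (free_mult X (Suc k) c)"
    "free_mult X k (gtgt (free (free X)) k c) = gtgt (free X) k (free_mult X (Suc k) c)"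
    using t s f X' assms tclass_eq[OF conjunct1[OF e]] tclass_eq[OF conjunct2[OF e]]
    by (simp_all add: gsrc_free free_mult_tclass)
qed

text \<open>On generators both sides represent the class \<open>free_map Y f n c\<close>, by
  different choices. For composites, composability of the images is extracted by \<open>twf\<close>
  from well-formedness of the whole image.\<close>

lemma tmap_tflat:
  assumes X: "globular_set X" and Y: "globular_set Y" and f: "globular_map X Y f"
  shows "twf (free X) t n \<Longrightarrow>
    teq Y n (tmap f (tflat t) n) (tflat (tmap (free_map Y f) t n))"
proof (induction t arbitrary: n)
  case (Gen c)
  let ?s = "SOME t. t \<in> c"
  have c: "teq X n ?s ?s" "tclass X n ?s = c" using Gen some_in_class[of c X] by auto
  then have "free_map Y f n c = tclass Y n (tmap f ?s n)"
    using free_map_tclass[OF X f c(1)] by simp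
  then show ?case using tmap_teq[OF X f c(1)] some_in_tclass teq_sym by simp blast
next
  case (Idt u)
  then show ?case by (auto intro: teq_idt)
next
  case (Cmp k u v)
  have "teq Y n (tmap f (tflat (Cmp k u v)) n) (tmap f (tflat (Cmp k u v)) n)"
    using tmap_teq[OF X f] tflat_teq[OF X] twf_teq Cmp.prems by blast
  then have "composable Y k n (tmap f (tflat u) n) (tmap f (tflat v) n)"
    using teq_twf[OF Y] by simp
  then show ?case using Cmp by (auto intro!: teq_Cmp)
qed

lemma free_mult_natural:
  assumes X: "globular_set X" and Y: "globular_set Y" and f: "globular_map X Y f"
    and c: "c \<in> cells (free (free X)) n"
  shows "free_map Y f n (free_mult X n c) = free_mult Y n (free_map (free Y) (free_map Y f) n c)"
proof -
  obtain t where t: "c = tclass (free X) n t" "teq (free X) n t t" using c by (rule cells_freeE)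
  have X': "globular_set (free X)" using X by (rule globular_free)
  note f' = free_map_globular[OF X Y f]
  show ?thesis
    using t X X' Y f f' tflat_teq[OF X t(2)] tmap_teq[OF X' f' t(2)]
      tclass_eq[OF tmap_tflat[OF X Y f iffD1[OF teq_twf[OF X'] t(2)]]]
    by (simp add: free_map_tclass free_mult_tclass)
qed

text \<open>Associativity of the multiplication at the level of terms. On generators it is the
  description of \<open>free_mult\<close> by any representative; composites follow the pattern of
  naturality.\<close>

lemma tflat_tflat:
  assumes X: "globular_set X"
  shows "twf (free (free X)) t n \<Longrightarrow>
    teq X n (tflat (tflat t)) (tflat (tmap (free_mult X) t n))"
proof (induction t arbitrary: n)
  case (Gen c)
  let ?s = "SOME t. t \<in> c"
  have c: "teq (free X) n ?s ?s" "tclass (free X) n ?s = c"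
    using Gen some_in_class[of c "free X"] by auto
  then have "free_mult X n c = tclass X n (tflat ?s)"
    using free_mult_tclass[OF X c(1)] by simp
  then show ?case using tflat_teq[OF X c(1)] some_in_tclass teq_sym by simp blast
next
  case (Idt u)
  then show ?case by (auto intro: teq_idt)
next
  case (Cmp k u v)
  have "teq X n (tflat (tflat (Cmp k u v))) (tflat (tflat (Cmp k u v)))"
    using tflat_teq[OF globular_free[OF X]] tflat_teq[OF X] twf_teq Cmp.prems by blast
  then have "composable X k n (tflat (tflat u)) (tflat (tflat v))"
    using teq_twf[OF X] by simp
  then show ?case using Cmp by (auto intro!: teq_Cmp)
qed

lemma free_mult_assoc:
  assumes X: "globular_set X" and c: "c \<in> cells (free (free (free X))) n"
  shows "free_mult X n (free_mult (free X) n c) = free_mult X n (free_map (free X) (free_mult X) n c)"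
proof -
  obtain t where t: "c = tclass (free (free X)) n t" "teq (free (free X)) n t t" using c by (rule cells_freeE)
  have X': "globular_set (free X)" using X by (rule globular_free)
  have X'': "globular_set (free (free X))" using X' by (rule globular_free)
  note m = free_mult_globular[OF X]
  show ?thesis
    using t X X' X'' m tflat_teq[OF X' t(2)] tmap_teq[OF X'' m t(2)]
      tclass_eq[OF tflat_tflat[OF X iffD1[OF teq_twf[OF X''] t(2)]]]
    by (simp add: free_map_tclass free_mult_tclass)
qed

lemma free_mult_unit:
  assumes "globular_set X" "c \<in> cells (free X) n"
  shows "free_mult X n (free_unit (free X) n c) = c"
  using assms some_in_class(2)[OF assms(2)] by (simp add: free_unit_def free_mult_tclass teq_gen)

lemma tflat_tmap_unit:
  assumes X: "globular_set X"
  shows "twf X t n \<Longrightarrow> teq X n (tflat (tmap (free_unit X) t n)) t"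
proof (induction t arbitrary: n)
  case (Gen x)
  then show ?case using some_in_tclass[of X n "Gen x"] by (simp add: free_unit_def teq_gen)
next
  case (Idt u)
  then show ?case by (auto intro: teq_idt)
next
  case (Cmp k u v)
  then have "composable X k n (tflat (tmap (free_unit X) u n)) (tflat (tmap (free_unit X) v n))"
    using composable_cong[OF X] by (metis less_imp_le teq_sym twf.simps(3))
  then show ?case using Cmp by (auto intro!: teq_Cmp)
qed

lemma free_mult_map_unit:
  assumes X: "globular_set X" and c: "c \<in> cells (free X) n"
  shows "free_mult X n (free_map (free X) (free_unit X) n c) = c"
proof -
  obtain t where t: "c = tclass X n t" "teq X n t t" using c by (rule cells_freeE)
  note u = free_unit_globular[OF X]
  show ?thesis
    using t X u globular_free[OF X] tmap_teq[OF X u t(2)]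
      tclass_eq[OF tflat_tmap_unit[OF X iffD1[OF teq_twf[OF X] t(2)]]]
    by (simp add: free_map_tclass free_mult_tclass)
qed

section \<open>Collections and their products\<close>

lemma globular_map_comp:
  "globular_map X Y g \<Longrightarrow> globular_map Y Z f \<Longrightarrow> globular_map X Z (f \<odot> g)"
  by (auto simp: globular_map_def map_comp_glob_def)

lemma coll_map_comp: "coll_map X Y g \<Longrightarrow> coll_map Y Z f \<Longrightarrow> coll_map X Z (f \<odot> g)"
  by (auto simp: coll_map_def globular_map_def map_comp_glob_def map_eq_def)

lemma coll_map_id: "coll_map X X id_map"
  by (auto simp: coll_map_def globular_map_def map_comp_glob_def map_eq_def id_map_def)

lemma globular_one: "globular_set one_glob"
  by (simp add: globular_set_def one_glob_def)

lemma bang_globular: "globular_map X one_glob bang"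
  by (simp add: globular_map_def one_glob_def)

lemma bang_comp: "bang \<odot> f = bang"
  by (simp add: map_comp_glob_def fun_eq_iff)

lemmas globular_free_one = globular_free[OF globular_one]

lemma collectionD:
  assumes "collection X"
  shows "globular_set X" "globular_map X (free one_glob) (ar X)"
  using assms by (auto simp: collection_def)

lemma coll_mapD:
  assumes "coll_map X Y f"
  shows "globular_map X Y f" "x \<in> cells X k \<Longrightarrow> f k x \<in> cells Y k"
    "x \<in> cells X k \<Longrightarrow> ar Y k (f k x) = ar X k x"
  using assms by (auto simp: coll_map_def globular_map_def map_eq_def map_comp_glob_def)

text \<open>\<open>free_map one_glob bang\<close> extracts the shape of a pasting diagram, and
  relabelling by a globular map leaves the shape alone. This keeps pairs inside the pullback
  defining the tensor product.\<close>

lemma free_map_bang_comp: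
  assumes "globular_set X" "globular_set Y" "globular_map X Y f" "c \<in> cells (free X) k"
  shows "free_map one_glob bang k (free_map Y f k c) = free_map one_glob bang k c"
  using free_map_comp[OF assms(1-3) bang_globular assms(4)] by (simp add: bang_comp)

subsection \<open>Cartesian product\<close>

lemma cprod_simps:
  "cells (X \<times>\<^sub>c Y) k = {(x, y). x \<in> cells X k \<and> y \<in> cells Y k \<and> ar X k x = ar Y k y}"
  "gsrc (X \<times>\<^sub>c Y) k p = (gsrc X k (fst p), gsrc Y k (snd p))"
  "gtgt (X \<times>\<^sub>c Y) k p = (gtgt X k (fst p), gtgt Y k (snd p))"
  "ar (X \<times>\<^sub>c Y) k p = ar X k (fst p)"
  by (auto simp: cprod_def map_prod_def split: prod.split)

lemma collection_cprod: "collection X \<Longrightarrow> collection Y \<Longrightarrow> collection (X \<times>\<^sub>c Y)"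
  by (auto simp: collection_def globular_set_def globular_map_def cprod_simps)

lemma coll_map_proj1: "coll_map (X \<times>\<^sub>c Y) X proj1"
  and coll_map_proj2: "coll_map (X \<times>\<^sub>c Y) Y proj2"
  by (auto simp: coll_map_def globular_map_def map_eq_def map_comp_glob_def cprod_simps
      proj1_def proj2_def)

lemma coll_map_pair:
  "coll_map W X f \<Longrightarrow> coll_map W Y g \<Longrightarrow> coll_map W (X \<times>\<^sub>c Y) (\<lambda>k w. (f k w, g k w))"
  by (auto simp: coll_map_def globular_map_def map_eq_def map_comp_glob_def cprod_simps)

lemma coll_map_cprod_map:
  assumes "coll_map X X' f" "coll_map Y Y' g"
  shows "coll_map (X \<times>\<^sub>c Y) (X' \<times>\<^sub>c Y') (cprod_map f g)"
  using coll_map_pair[OF coll_map_comp[OF coll_map_proj1 assms(1)]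
      coll_map_comp[OF coll_map_proj2 assms(2)]]
  by (simp add: cprod_map_def[abs_def] map_comp_glob_def proj1_def proj2_def map_prod_def
      case_prod_unfold)

lemma coll_map_cprod_assoc: "coll_map ((X \<times>\<^sub>c Y) \<times>\<^sub>c Z) (X \<times>\<^sub>c (Y \<times>\<^sub>c Z)) cprod_assoc"
  by (auto simp: coll_map_def globular_map_def map_eq_def map_comp_glob_def cprod_simps
      cprod_assoc_def)

subsection \<open>Composition tensor product\<close>

lemma tens_simps:
  "cells (X \<box> Y) k = {(x, c). x \<in> cells X k \<and> c \<in> cells (free Y) k \<and>
     ar X k x = free_map one_glob bang k c}"
  "gsrc (X \<box> Y) k p = (gsrc X k (fst p), gsrc (free Y) k (snd p))"
  "gtgt (X \<box> Y) k p = (gtgt X k (fst p), gtgt (free Y) k (snd p))"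
  "ar (X \<box> Y) k p = free_mult one_glob k (free_map (free one_glob) (ar Y) k (snd p))"
  by (auto simp: tens_def map_prod_def split: prod.split)

lemma tens_proj_globular:
  "globular_map (X \<box> Y) X proj1" "globular_map (X \<box> Y) (free Y) proj2"
  by (auto simp: globular_map_def tens_simps proj1_def proj2_def)

lemma collection_tens:
  assumes X: "collection X" and Y: "collection Y"
  shows "collection (X \<box> Y)"
proof -
  note X' = collectionD[OF X] and Y' = collectionD[OF Y]
  note b = globular_mapD[OF free_map_globular[OF Y'(1) globular_one bang_globular]]
  have "globular_set (X \<box> Y)"
    using X'(1) globular_free[OF Y'(1)] globular_mapD[OF X'(2)] b
    unfolding globular_set_def by (simp add: tens_simps split: prod.splits)
  moreover have "globular_map (X \<box> Y) (free one_glob)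
      (free_mult one_glob \<odot> free_map (free one_glob) (ar Y) \<odot> proj2)"
    using globular_map_comp[OF globular_map_comp[OF tens_proj_globular(2)
          free_map_globular[OF Y'(1) globular_free_one Y'(2)]] free_mult_globular[OF globular_one]] .
  ultimately show ?thesis
    by (simp add: collection_def globular_map_def tens_simps map_comp_glob_def proj2_def)
qed

text \<open>The universal property of the pullback: the third premise is commutativity of the
  square, the fourth is preservation of arities.\<close>

lemma coll_map_into_tens:
  assumes "globular_map W X f" "globular_map W (free Y) g"
    and "\<And>k w. w \<in> cells W k \<Longrightarrow> ar X k (f k w) = free_map one_glob bang k (g k w)"
    and "\<And>k w. w \<in> cells W k \<Longrightarrow>
      free_mult one_glob k (free_map (free one_glob) (ar Y) k (g k w)) = ar W k w"
  shows "coll_map W (X \<box> Y) (\<lambda>k w. (f k w, g k w))"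
  using assms by (auto simp: coll_map_def globular_map_def map_eq_def map_comp_glob_def tens_simps)

lemma coll_map_tens_map:
  assumes Y: "collection Y" and Y': "collection Y'" and f: "coll_map X X' f" and g: "coll_map Y Y' g"
  shows "coll_map (X \<box> Y) (X' \<box> Y') (tens_map Y' f g)"
proof -
  note GY = collectionD(1)[OF Y] and GY' = collectionD(1)[OF Y'] and Gg = coll_mapD(1)[OF g]
  have e: "map_eq Y (ar Y' \<odot> g) (ar Y)" using g by (simp add: coll_map_def)
  have "coll_map (X \<box> Y) (X' \<box> Y') (\<lambda>k w. ((f \<odot> proj1) k w, (free_map Y' g \<odot> proj2) k w))"
  proof (rule coll_map_into_tens)
    show "globular_map (X \<box> Y) X' (f \<odot> proj1)"
      by (rule globular_map_comp[OF tens_proj_globular(1) coll_mapD(1)[OF f]])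
    show "globular_map (X \<box> Y) (free Y') (free_map Y' g \<odot> proj2)"
      by (rule globular_map_comp[OF tens_proj_globular(2) free_map_globular[OF GY GY' Gg]])
  next
    fix k w assume "w \<in> cells (X \<box> Y) k"
    then show "ar X' k ((f \<odot> proj1) k w) = free_map one_glob bang k ((free_map Y' g \<odot> proj2) k w)"
      using coll_mapD(3)[OF f] free_map_bang_comp[OF GY GY' Gg]
      by (auto simp: tens_simps map_comp_glob_def proj1_def proj2_def)
  next
    fix k w assume "w \<in> cells (X \<box> Y) k"
    then show "free_mult one_glob k (free_map (free one_glob) (ar Y') k ((free_map Y' g \<odot> proj2) k w))
      = ar (X \<box> Y) k w"
      by (auto simp: tens_simps map_comp_glob_def[of "free_map Y' g"] proj2_def
          free_map_comp[OF GY GY' Gg collectionD(2)[OF Y']] free_map_cong[OF GY e])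
  qed
  then show ?thesis
    by (simp add: tens_map_def[abs_def] map_comp_glob_def proj1_def proj2_def map_prod_def
        case_prod_unfold)
qed

text \<open>That the values lie in the outer pullback is naturality of the multiplication along
  \<open>bang\<close>; that arities are preserved is naturality along \<open>ar Z\<close> followed
  by associativity of the multiplication.\<close>

lemma coll_map_tens_assoc:
  assumes Y: "collection Y" and Z: "collection Z"
  shows "coll_map (X \<box> (Y \<box> Z)) ((X \<box> Y) \<box> Z) (tens_assoc Y Z)"
proof -
  note GY = collectionD[OF Y] and GZ = collectionD[OF Z]
    and GYZ = collectionD[OF collection_tens[OF Y Z]]
  note o = globular_one and fo = globular_free_one
  note fZ = globular_free[OF GZ(1)] and p = tens_proj_globular[of Y Z]
  note b = free_map_globular[OF GZ(1) o bang_globular]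
    and a = free_map_globular[OF GZ(1) fo GZ(2)]
  note g1 = free_map_globular[OF GYZ(1) GY(1) p(1)]
  have g2: "globular_map (free (Y \<box> Z)) (free Z) (free_mult Z \<odot> free_map (free Z) proj2)"
    by (rule globular_map_comp[OF free_map_globular[OF GYZ(1) fZ p(2)] free_mult_globular[OF GZ(1)]])
  let ?f1 = "\<lambda>k w. (proj1 k w, (free_map Y proj1 \<odot> proj2) k w)"
  let ?f2 = "(free_mult Z \<odot> free_map (free Z) proj2) \<odot> proj2"
  have f1: "globular_map (X \<box> (Y \<box> Z)) (X \<box> Y) ?f1"
    using tens_proj_globular(1)[of X "Y \<box> Z"]
      globular_map_comp[OF tens_proj_globular(2)[of X "Y \<box> Z"] g1]
      free_map_bang_comp[OF GYZ(1) GY(1) p(1)]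
    by (auto simp: globular_map_def tens_simps map_comp_glob_def proj1_def proj2_def)
  \<comment> \<open>The pullback condition of the inner tensor product, read as an equation of maps
    so that it can be applied under \<open>free_map\<close>.\<close>
  have e1: "map_eq (Y \<box> Z) (free_map one_glob bang \<odot> proj2) (ar Y \<odot> proj1)"
    by (auto simp: map_eq_def tens_simps map_comp_glob_def proj1_def proj2_def)
  have e2: "map_eq (Y \<box> Z) (free_mult one_glob \<odot> free_map (free one_glob) (ar Z) \<odot> proj2)
      (ar (Y \<box> Z))"
    by (auto simp: map_eq_def tens_simps map_comp_glob_def proj2_def)
  have "coll_map (X \<box> (Y \<box> Z)) ((X \<box> Y) \<box> Z) (\<lambda>k w. (?f1 k w, ?f2 k w))"
  proof (rule coll_map_into_tens[OF f1])
    show "globular_map (X \<box> (Y \<box> Z)) (free Z) ?f2"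
      by (rule globular_map_comp[OF tens_proj_globular(2) g2])
  next
    fix k w assume "w \<in> cells (X \<box> (Y \<box> Z)) k"
    then have c: "snd w \<in> cells (free (Y \<box> Z)) k" by (auto simp: tens_simps)
    let ?c = "snd w"
    have m: "free_map (free Z) proj2 k ?c \<in> cells (free (free Z)) k"
      using globular_mapD(1)[OF free_map_globular[OF GYZ(1) fZ p(2)] c] .
    have "free_map one_glob bang k (?f2 k w) =
      free_mult one_glob k (free_map (free one_glob) (free_map one_glob bang \<odot> proj2) k ?c)"
      using free_mult_natural[OF GZ(1) o bang_globular m] free_map_comp[OF GYZ(1) fZ p(2) b c]
      by (simp add: map_comp_glob_def[of "free_mult Z"] map_comp_glob_def[of _ proj2] proj2_def)
    also have "\<dots> = free_mult one_glob k (free_map (free one_glob) (ar Y \<odot> proj1) k ?c)"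
      by (simp add: free_map_cong[OF GYZ(1) e1 c])
    also have "\<dots> = ar (X \<box> Y) k (?f1 k w)"
      using free_map_comp[OF GYZ(1) GY(1) p(1) GY(2) c]
      by (simp add: tens_simps map_comp_glob_def[of "free_map Y proj1"] proj2_def[of k w])
    finally show "ar (X \<box> Y) k (?f1 k w) = free_map one_glob bang k (?f2 k w)" by simp
  next
    fix k w assume "w \<in> cells (X \<box> (Y \<box> Z)) k"
    then have c: "snd w \<in> cells (free (Y \<box> Z)) k" by (auto simp: tens_simps)
    let ?c = "snd w" and ?a = "free_map (free one_glob) (ar Z)"
    have m: "free_map (free Z) proj2 k ?c \<in> cells (free (free Z)) k"
      using globular_mapD(1)[OF free_map_globular[OF GYZ(1) fZ p(2)] c] .
    have ap: "globular_map (Y \<box> Z) (free (free one_glob)) (?a \<odot> proj2)"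
      by (rule globular_map_comp[OF p(2) a])
    have m': "free_map (free (free one_glob)) (?a \<odot> proj2) k ?c
        \<in> cells (free (free (free one_glob))) k"
      using globular_mapD(1)[OF free_map_globular[OF GYZ(1) globular_free[OF fo] ap] c] .
    have "?a k (?f2 k w) = free_mult (free one_glob) k
        (free_map (free (free one_glob)) ?a k (free_map (free Z) proj2 k ?c))"
      using free_mult_natural[OF GZ(1) fo GZ(2) m]
      by (simp add: map_comp_glob_def proj2_def)
    also have "\<dots> = free_mult (free one_glob) k (free_map (free (free one_glob)) (?a \<odot> proj2) k ?c)"
      using free_map_comp[OF GYZ(1) fZ p(2) a c] by simp
    finally have "free_mult one_glob k (?a k (?f2 k w)) =
      free_mult one_glob k (free_map (free one_glob) (free_mult one_glob) k
        (free_map (free (free one_glob)) (?a \<odot> proj2) k ?c))"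
      using free_mult_assoc[OF o m'] by simp
    also have "\<dots> = free_mult one_glob k
        (free_map (free one_glob) (free_mult one_glob \<odot> ?a \<odot> proj2) k ?c)"
      using free_map_comp[OF GYZ(1) globular_free[OF fo] ap free_mult_globular[OF o] c] by simp
    also have "\<dots> = ar (X \<box> (Y \<box> Z)) k w"
      by (simp add: free_map_cong[OF GYZ(1) e2 c] tens_simps(4)[of X])
    finally show "free_mult one_glob k (?a k (?f2 k w)) = ar (X \<box> (Y \<box> Z)) k w" .
  qed
  then show ?thesis
    by (simp add: tens_assoc_def[abs_def] map_comp_glob_def proj1_def[abs_def] proj2_def[abs_def]
        case_prod_unfold)
qed

lemma collection_unit: "collection unit_coll"
proof -
  have "globular_set unit_coll" by (simp add: globular_set_def unit_coll_def one_glob_def)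
  moreover have "globular_map unit_coll (free one_glob) (ar unit_coll)"
    using free_unit_globular[OF globular_one]
    by (simp only: globular_map_def unit_coll_def glob.select_convs coll.select_convs)
  ultimately show ?thesis by (simp add: collection_def)
qed

lemma coll_map_tens_unit_left:
  assumes "collection X"
  shows "coll_map X (unit_coll \<box> X) (tens_unit_left X)"
proof -
  note X = collectionD[OF assms]
  have "coll_map X (unit_coll \<box> X) (\<lambda>k w. (bang k w, free_unit X k w))"
  proof (rule coll_map_into_tens)
    show "globular_map X unit_coll bang"
      by (simp add: globular_map_def unit_coll_def one_glob_def)
    show "globular_map X (free X) (free_unit X)" by (rule free_unit_globular[OF X(1)])
  next
    fix k w assume w: "w \<in> cells X k"
    then show "ar unit_coll k (bang k w) = free_map one_glob bang k (free_unit X k w)"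
      using free_unit_natural[OF X(1) bang_globular w] by (simp add: unit_coll_def)
    show "free_mult one_glob k (free_map (free one_glob) (ar X) k (free_unit X k w)) = ar X k w"
      using free_unit_natural[OF X w] free_mult_unit[OF globular_one globular_mapD(1)[OF X(2) w]]
      by simp
  qed
  then show ?thesis by (simp add: tens_unit_left_def[abs_def] bang_def)
qed

text \<open>The arity of the unit collection is the monad unit after \<open>bang\<close>, so the
  arity of a diagram of unit cells is its shape by the law that multiplication after the mapped unit
  is the identity. The pullback condition identifies this shape with the arity of the first
  component.\<close>

lemma coll_map_tens_unit_right: "coll_map (X \<box> unit_coll) X proj1"
proof -
  note U = collectionD[OF collection_unit]
  have e: "free_unit one_glob \<odot> bang = ar unit_coll"
    by (simp add: unit_coll_def map_comp_glob_def fun_eq_iff)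
  have "free_map one_glob bang k c = free_mult one_glob k (free_map (free one_glob) (ar unit_coll) k c)"
    if c: "c \<in> cells (free unit_coll) k" for k c
    using free_mult_map_unit[OF globular_one
        globular_mapD(1)[OF free_map_globular[OF U(1) globular_one bang_globular] c]]
      free_map_comp[OF U(1) globular_one bang_globular free_unit_globular[OF globular_one] c] e
    by simp
  then show ?thesis
    using tens_proj_globular(1)[of X unit_coll]
    by (auto simp: coll_map_def map_eq_def tens_simps map_comp_glob_def proj1_def)
qed

text \<open>Being induced by the projections, the map is the pairing of two instances of
  \<open>tens_map\<close>, which makes it a collection map without any new computation.\<close>

lemma coll_map_tens_interchange:
  fixes A :: "'a coll" and B :: "'b coll" and C :: "'c coll" and D :: "'d coll"
  assumes C: "collection C" and D: "collection D"
  shows "coll_map ((A \<times>\<^sub>c B) \<box> (C \<times>\<^sub>c D)) ((A \<box> C) \<times>\<^sub>c (B \<box> D)) (tens_interchange C D)"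
proof -
  note CD = collection_cprod[OF C D]
  have 1: "coll_map ((A \<times>\<^sub>c B) \<box> (C \<times>\<^sub>c D)) (A \<box> C) (tens_map C proj1 proj1)"
    by (rule coll_map_tens_map[OF CD C coll_map_proj1 coll_map_proj1])
  have 2: "coll_map ((A \<times>\<^sub>c B) \<box> (C \<times>\<^sub>c D)) (B \<box> D) (tens_map D proj2 proj2)"
    by (rule coll_map_tens_map[OF CD D coll_map_proj2 coll_map_proj2])
  have "tens_interchange C D = (\<lambda>k (w :: ('a \<times> 'b) \<times> ('c \<times> 'd) gterm set).
    (tens_map C proj1 proj1 k w, tens_map D proj2 proj2 k w))"
    by (simp add: tens_interchange_def tens_map_def fun_eq_iff map_prod_def proj1_def[abs_def]
        proj2_def[abs_def] split: prod.split)
  then show ?thesis using coll_map_pair[OF 1 2] by simp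
qed

subsection \<open>The terminal collection and copowers\<close>

lemma terminal_simps:
  "cells terminal_coll = cells (free one_glob)" "gsrc terminal_coll = gsrc (free one_glob)"
  "gtgt terminal_coll = gtgt (free one_glob)" "ar terminal_coll = id_map"
  by (simp_all add: terminal_coll_def)

lemma collection_terminal: "collection terminal_coll"
  using globular_free_one
  by (simp add: collection_def globular_set_def globular_map_def terminal_simps id_map_def)

lemma coll_map_ar: "collection X \<Longrightarrow> coll_map X terminal_coll (ar X)"
  by (simp add: collection_def coll_map_def globular_map_def map_eq_def map_comp_glob_def
      terminal_simps id_map_def)

lemma copower_simps:
  "cells (A \<cdot>\<^sub>c X) k = A \<times> cells X k"
  "gsrc (A \<cdot>\<^sub>c X) k p = (fst p, gsrc X k (snd p))"
  "gtgt (A \<cdot>\<^sub>c X) k p = (fst p, gtgt X k (snd p))"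
  "ar (A \<cdot>\<^sub>c X) k p = ar X k (snd p)"
  by (auto simp: copower_def split: prod.split)

lemma collection_copower: "collection X \<Longrightarrow> collection (A \<cdot>\<^sub>c X)"
  by (auto simp: collection_def globular_set_def globular_map_def copower_simps)

lemma coll_map_incl: "a \<in> A \<Longrightarrow> coll_map X (A \<cdot>\<^sub>c X) (incl a)"
  by (auto simp: coll_map_def globular_map_def map_eq_def map_comp_glob_def copower_simps incl_def)

lemma copower_proj2_globular: "globular_map (A \<cdot>\<^sub>c X) X proj2"
  by (auto simp: globular_map_def copower_simps proj2_def)

text \<open>The second component commutes with boundaries because arity maps are globular, so what
  remains is that the label does not change along boundaries.\<close>

lemma coll_map_into_copower_terminal:
  assumes "collection W"
    and "\<And>k w. w \<in> cells W k \<Longrightarrow> f k w = (l w, ar W k w) \<and> l w \<in> A"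
    and "\<And>k w. w \<in> cells W (Suc k) \<Longrightarrow> l (gsrc W k w) = l w \<and> l (gtgt W k w) = l w"
  shows "coll_map W (A \<cdot>\<^sub>c terminal_coll) f"
proof -
  have "gsrc W k w \<in> cells W k \<and> gtgt W k w \<in> cells W k" if "w \<in> cells W (Suc k)" for k w
    using collectionD(1)[OF assms(1)] that by (auto simp: globular_set_def)
  then show ?thesis
    using assms(2,3) collectionD(2)[OF assms(1)]
    by (auto simp: coll_map_def globular_map_def map_eq_def map_comp_glob_def copower_simps
        terminal_simps id_map_def)
qed

lemma map_eq_into_copower_terminal:
  assumes "coll_map W (A \<cdot>\<^sub>c terminal_coll) f" "coll_map W (A \<cdot>\<^sub>c terminal_coll) g"
    and "\<And>k w. w \<in> cells W k \<Longrightarrow> fst (f k w) = fst (g k w)"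
  shows "map_eq W f g"
  unfolding map_eq_def
  using coll_mapD(3)[OF assms(1)] coll_mapD(3)[OF assms(2)] assms(3)
  by (auto simp: copower_simps terminal_simps id_map_def prod_eq_iff)

section \<open>Labels of cells of the free category on a copower\<close>

text \<open>Pasting diagrams are connected, so all generators of a composite in the free category on
  \<open>B \<cdot>\<^sub>c Y\<close> lie in the same summand, which can be read off any one of them, such as the leftmost
  generator \<open>hgen t\<close>. The dimension of that generator is \<open>hdim t n\<close>.\<close>

primrec hgen :: "'a gterm \<Rightarrow> 'a" where
  "hgen (Gen x) = x"
| "hgen (Idt u) = hgen u"
| "hgen (Cmp k u v) = hgen u"

primrec hdim :: "'a gterm \<Rightarrow> nat \<Rightarrow> nat" where
  "hdim (Gen x) n = n"
| "hdim (Idt u) n = hdim u (n - 1)"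
| "hdim (Cmp k u v) n = hdim u n"

lemma hgen_in_set: "hgen t \<in> set_gterm t"
  by (induction t) auto

lemma hgen_in_cells: "twf X t n \<Longrightarrow> hgen t \<in> cells X (hdim t n)"
  by (induction t arbitrary: n) auto

lemma hgen_tmap: "hgen (tmap f t n) = f (hdim t n) (hgen t)"
  by (induction t arbitrary: n) auto

lemma hgen_tflat: "hgen (tflat t) = hgen (SOME s. s \<in> hgen t)"
  by (induction t) auto

text \<open>All generators are constrained, not just the leftmost: the label of the leftmost
  generator alone is no inductive invariant, since a source may keep only the right-hand factor of a
  composite.\<close>

definition labelled :: "'i \<Rightarrow> ('i \<times> 'a) gterm \<Rightarrow> bool" where
  "labelled b t \<longleftrightarrow> (\<forall>x\<in>set_gterm t. fst x = b)"

lemma labelled_simps [simp]: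
  "labelled b (Gen x) \<longleftrightarrow> fst x = b" "labelled b (Idt u) \<longleftrightarrow> labelled b u"
  "labelled b (Cmp k u v) \<longleftrightarrow> labelled b u \<and> labelled b v"
  by (auto simp: labelled_def)

lemma labelled_hgen: "labelled b t \<Longrightarrow> fst (hgen t) = b"
  using hgen_in_set by (auto simp: labelled_def)

lemma labelled_unique: "labelled b t \<Longrightarrow> labelled b' t \<Longrightarrow> b = b'"
  using labelled_hgen by metis

lemma labelled_tsrc:
  "labelled b t \<Longrightarrow> labelled b (tsrc (B \<cdot>\<^sub>c Y) n t) \<and> labelled b (ttgt (B \<cdot>\<^sub>c Y) n t)"
  by (induction t) (auto simp: copower_simps)

lemma labelled_tsrc_to:
  "labelled b t \<Longrightarrow> labelled b (tsrc_to (B \<cdot>\<^sub>c Y) k n t) \<and> labelled b (ttgt_to (B \<cdot>\<^sub>c Y) k n t)"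
  by (induction n arbitrary: t) (auto simp: iter_bd.simps labelled_tsrc)

lemma labelled_Idt_pow: "labelled b ((Idt ^^ m) u) \<longleftrightarrow> labelled b u"
  by (induction m) auto

text \<open>Labels are inherited by boundaries, and a term has at least one generator, hence at most
  one label; a common label on the shared boundary therefore forces the two labels to agree.\<close>

lemma composable_labelled:
  assumes "\<exists>b. labelled b (tsrc_to (B \<cdot>\<^sub>c Y) k n u) \<and> labelled b (ttgt_to (B \<cdot>\<^sub>c Y) k n v)"
    and "labelled a u" "labelled a' v"
  shows "a = a'"
  using assms by (metis labelled_tsrc_to labelled_unique)

text \<open>Connectedness, by induction on derivations. The premises in lower dimensions now matter:
  their induction hypotheses give the shared boundary a label, which glues the labels of the two
  factors.\<close>

lemma teq_labelled: "teq (B \<cdot>\<^sub>c Y) n t u \<Longrightarrow> \<exists>b\<in>B. labelled b t \<and> labelled b u"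
proof (induction rule: teq.induct)
  case (teq_gen x n)
  then show ?case by (auto simp: copower_simps)
next
  case (teq_cmp k n u u' v v')
  obtain a a' where a: "a \<in> B" "labelled a u" "labelled a u'" "labelled a' v" "labelled a' v'"
    using teq_cmp.IH(1,2) by blast
  then have "a = a'" using composable_labelled[of B Y k n u v] teq_cmp.IH(3) by blast
  then show ?case using a by auto
next
  case (teq_trans n u v w)
  then obtain b b' where b: "b \<in> B" "labelled b u" "labelled b v" "labelled b' v" "labelled b' w"
    by blast
  then have "b = b'" by (intro labelled_unique)
  then show ?case using b by blast
next
  case (teq_assoc k n u v w)
  obtain a a' a'' where a: "a \<in> B" "labelled a u" "labelled a' v" "labelled a'' w"
    using teq_assoc.IH(1-3) by blast
  then have "a = a'" "a' = a''"
    using composable_labelled[of B Y k n u v] composable_labelled[of B Y k n v w]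
      teq_assoc.IH(4,5) by blast+
  then show ?case using a by auto
next
  case (teq_interchange j k n u v u' v')
  obtain a b a' b' where a: "a \<in> B" "labelled a u" "labelled b v" "labelled a' u'" "labelled b' v'"
    using teq_interchange.IH(1-4) by blast
  then have "a = b" "a' = b'" "a = a'"
    using composable_labelled[of B Y k n u v] composable_labelled[of B Y k n u' v']
      composable_labelled[of B Y j n u u'] teq_interchange.IH(5-7) by blast+
  then show ?case using a by auto
next
  case (teq_idt_cmp k n u v)
  obtain a a' where a: "a \<in> B" "labelled a u" "labelled a' v"
    using teq_idt_cmp.IH(1,2) by blast
  then have "a = a'" using composable_labelled[of B Y k n u v] teq_idt_cmp.IH(3) by blast
  then show ?case using a by auto
next
  case (teq_unit_left k n u)
  then obtain b where b: "b \<in> B" "labelled b u" by blast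
  then show ?case using labelled_tsrc_to[OF b(2), of B Y k n] by (auto simp: labelled_Idt_pow)
next
  case (teq_unit_right k n u)
  then obtain b where b: "b \<in> B" "labelled b u" by blast
  then show ?case using labelled_tsrc_to[OF b(2), of B Y k n] by (auto simp: labelled_Idt_pow)
qed auto

section \<open>Labels of classes and their behaviour under the monad\<close>

definition hd_cell :: "'a gterm set \<Rightarrow> 'a" where
  "hd_cell c = hgen (SOME t. t \<in> c)"

text \<open>The head generator may have lower dimension than the diagram, because of identities, and
  maps are indexed by dimension. Generator and dimension are read off the same chosen
  representative; only the label is shown to be independent of that choice.\<close>

definition hd_dim :: "nat \<Rightarrow> 'a gterm set \<Rightarrow> nat" where
  "hd_dim k c = hdim (SOME t. t \<in> c) k"

definition label :: "('i \<times> 'a) gterm set \<Rightarrow> 'i" where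
  "label c = fst (hd_cell c)"

lemma hd_cell_in_cells:
  "globular_set W \<Longrightarrow> c \<in> cells (free W) k \<Longrightarrow> hd_cell c \<in> cells W (hd_dim k c)"
  unfolding hd_cell_def hd_dim_def using some_in_class(1) teq_twf hgen_in_cells by metis

lemma label_tclass:
  assumes "teq (B \<cdot>\<^sub>c Y) k t t"
  shows "label (tclass (B \<cdot>\<^sub>c Y) k t) = fst (hgen t)"
  unfolding label_def hd_cell_def
  using teq_labelled[OF some_in_tclass[OF assms]] labelled_hgen by metis

lemma label_in:
  assumes "c \<in> cells (free (B \<cdot>\<^sub>c Y)) k"
  shows "label c \<in> B"
proof -
  obtain b where b: "b \<in> B" "labelled b (SOME t. t \<in> c)"
    using teq_labelled[OF some_in_class(1)[OF assms]] by blast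
  then show ?thesis using labelled_hgen[OF b(2)] by (simp add: label_def hd_cell_def)
qed

lemma label_gsrc:
  assumes Y: "globular_set (B \<cdot>\<^sub>c Y)" and c: "c \<in> cells (free (B \<cdot>\<^sub>c Y)) (Suc k)"
  shows "label (gsrc (free (B \<cdot>\<^sub>c Y)) k c) = label c" "label (gtgt (free (B \<cdot>\<^sub>c Y)) k c) = label c"
proof -
  obtain t where t: "c = tclass (B \<cdot>\<^sub>c Y) (Suc k) t" "teq (B \<cdot>\<^sub>c Y) (Suc k) t t"
    using c by (auto simp: cells_free)
  obtain b where b: "labelled b t" using teq_labelled[OF t(2)] by blast
  then show "label (gsrc (free (B \<cdot>\<^sub>c Y)) k c) = label c"
    "label (gtgt (free (B \<cdot>\<^sub>c Y)) k c) = label c"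
    using t Y teq_tsrc[OF Y t(2)] labelled_hgen[OF b]
      labelled_hgen[OF conjunct1[OF labelled_tsrc[OF b]]]
      labelled_hgen[OF conjunct2[OF labelled_tsrc[OF b]]]
    by (auto simp: gsrc_free label_tclass)
qed

text \<open>The label of an image can be computed on any representative, in particular on the image
  of the chosen one, whose head is the image of the head. Thus one value of \<open>f\<close>
  suffices.\<close>

lemma label_free_map:
  assumes W: "globular_set W" and f: "globular_map W (B \<cdot>\<^sub>c Y) f" and c: "c \<in> cells (free W) k"
  shows "label (free_map (B \<cdot>\<^sub>c Y) f k c) = fst (f (hd_dim k c) (hd_cell c))"
proof -
  let ?t = "SOME t. t \<in> c"
  have t: "teq W k ?t ?t" "tclass W k ?t = c" using some_in_class[OF c] .
  have "label (free_map (B \<cdot>\<^sub>c Y) f k (tclass W k ?t)) = fst (hgen (tmap f ?t k))"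
    using free_map_tclass[OF W f t(1)] label_tclass[OF tmap_teq[OF W f t(1)]] by simp
  then show ?thesis using t(2) by (simp add: hgen_tmap hd_dim_def hd_cell_def)
qed

text \<open>The version for substitution of diagrams: the head of a flattened term is the head of
  the diagram standing at its leftmost position.\<close>

lemma label_free_mult_free_map:
  assumes W: "globular_set W" and Y: "globular_set (B \<cdot>\<^sub>c Y)"
    and f: "globular_map W (free (B \<cdot>\<^sub>c Y)) f" and c: "c \<in> cells (free W) k"
  shows "label (free_mult (B \<cdot>\<^sub>c Y) k (free_map (free (B \<cdot>\<^sub>c Y)) f k c)) =
    label (f (hd_dim k c) (hd_cell c))"
proof -
  let ?t = "SOME t. t \<in> c"
  have t: "teq W k ?t ?t" "tclass W k ?t = c" using some_in_class[OF c] .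
  have "label (free_mult (B \<cdot>\<^sub>c Y) k (free_map (free (B \<cdot>\<^sub>c Y)) f k (tclass W k ?t))) =
    fst (hgen (tflat (tmap f ?t k)))"
    using free_map_tclass[OF W f t(1)] free_mult_tclass[OF Y tmap_teq[OF W f t(1)]]
      label_tclass[OF tflat_teq[OF Y tmap_teq[OF W f t(1)]]] by simp
  then show ?thesis using t(2)
    by (simp add: hgen_tmap hgen_tflat hd_dim_def hd_cell_def label_def)
qed

lemma label_free_unit:
  "x \<in> cells (B \<cdot>\<^sub>c Y) k \<Longrightarrow> label (free_unit (B \<cdot>\<^sub>c Y) k x) = fst x"
  by (simp add: free_unit_def label_tclass teq_gen)

lemma tmap_incl_proj2: "labelled b t \<Longrightarrow> tmap (incl b \<odot> proj2) t n = t"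
  by (induction t arbitrary: n) (auto simp: map_comp_glob_def incl_def proj2_def)

text \<open>Every generator of a representative carries the label of the class, so stripping all
  labels and attaching that one label again changes nothing.\<close>

lemma free_map_incl_label:
  assumes Y: "collection Y" and c: "c \<in> cells (free (B \<cdot>\<^sub>c Y)) k"
  shows "free_map (B \<cdot>\<^sub>c Y) (incl (label c)) k (free_map Y proj2 k c) = c"
proof -
  note Y' = collectionD(1)[OF Y] and BY = collectionD(1)[OF collection_copower[OF Y, of B]]
  let ?t = "SOME t. t \<in> c"
  have t: "teq (B \<cdot>\<^sub>c Y) k ?t ?t" "tclass (B \<cdot>\<^sub>c Y) k ?t = c" using some_in_class[OF c] .
  obtain b where b: "b \<in> B" "labelled b ?t" using teq_labelled[OF t(1)] by blast
  then have l: "label c = b" using labelled_hgen by (simp add: label_def hd_cell_def)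
  note i = coll_mapD(1)[OF coll_map_incl[OF b(1), of Y]]
  have "free_map (B \<cdot>\<^sub>c Y) (incl b) k (free_map Y proj2 k c) =
    free_map (B \<cdot>\<^sub>c Y) (incl b \<odot> proj2) k (tclass (B \<cdot>\<^sub>c Y) k ?t)"
    using free_map_comp[OF BY Y' copower_proj2_globular i c] t(2) by simp
  also have "\<dots> = c"
    using free_map_tclass[OF BY globular_map_comp[OF copower_proj2_globular i] t(1)] t(2)
      tmap_incl_proj2[OF b(2)] by simp
  finally show ?thesis using l by simp
qed

text \<open>The converse of \<open>free_map_incl_label\<close>: together they identify cells of the
  free category on the copower with pairs of a label in \<open>B\<close> and a cell of the free
  category on \<open>Y\<close>.\<close>

lemma free_map_proj2_incl:
  fixes Y :: "'a coll"
  assumes Y: "collection Y" and b: "b \<in> B" and c: "c \<in> cells (free Y) k"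
  shows "free_map Y proj2 k (free_map (B \<cdot>\<^sub>c Y) (incl b) k c) = c"
    "label (free_map (B \<cdot>\<^sub>c Y) (incl b) k c) = b"
proof -
  note Y' = collectionD(1)[OF Y] and BY = collectionD(1)[OF collection_copower[OF Y, of B]]
  note i = coll_mapD(1)[OF coll_map_incl[OF b, of Y]]
  have "proj2 \<odot> incl b = (id_map :: nat \<Rightarrow> 'a \<Rightarrow> 'a)"
    by (simp add: map_comp_glob_def proj2_def incl_def id_map_def fun_eq_iff)
  then show "free_map Y proj2 k (free_map (B \<cdot>\<^sub>c Y) (incl b) k c) = c"
    using free_map_comp[OF Y' BY i copower_proj2_globular c] free_map_id[OF Y' c] by simp
  show "label (free_map (B \<cdot>\<^sub>c Y) (incl b) k c) = b"
    using label_free_map[OF Y' i c] by (simp add: incl_def)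
qed

lemma inv_on_eq:
  assumes "z \<in> cells X k" "f k z = w" "\<And>z'. z' \<in> cells X k \<Longrightarrow> f k z' = w \<Longrightarrow> z' = z"
  shows "inv_on X f k w = z"
proof -
  have "w \<in> f k ` cells X k" using assms by blast
  then show ?thesis unfolding inv_on_def using assms(3) inv_into_into f_inv_into_f by metis
qed

text \<open>The preimage consists of the two labels and the diagram without labels. Existence is
  \<open>free_map_incl_label\<close>, uniqueness is \<open>free_map_proj2_incl\<close>; both are
  needed to evaluate \<open>inv_into\<close>.\<close>

lemma inv_distr_tens:
  assumes X: "collection X" and Y: "collection Y" and z: "((a, x), c) \<in> cells ((A \<cdot>\<^sub>c X) \<box> (B \<cdot>\<^sub>c Y)) k"
  shows "inv_on ((A \<times> B) \<cdot>\<^sub>c (X \<box> Y)) (distr_tens B Y) k ((a, x), c) =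
    ((a, label c), (x, free_map Y proj2 k c))"
proof (rule inv_on_eq)
  note Y' = collectionD(1)[OF Y] and BY = collectionD(1)[OF collection_copower[OF Y, of B]]
  have c: "c \<in> cells (free (B \<cdot>\<^sub>c Y)) k" "a \<in> A" "x \<in> cells X k"
    "ar X k x = free_map one_glob bang k c"
    using z by (auto simp: tens_simps copower_simps)
  have p: "globular_map (free (B \<cdot>\<^sub>c Y)) (free Y) (free_map Y proj2)"
    by (rule free_map_globular[OF BY Y' copower_proj2_globular])
  show "((a, label c), (x, free_map Y proj2 k c)) \<in> cells ((A \<times> B) \<cdot>\<^sub>c (X \<box> Y)) k"
    using c label_in[OF c(1)] globular_mapD(1)[OF p c(1)]
      free_map_bang_comp[OF BY Y' copower_proj2_globular c(1)]
    by (simp add: copower_simps tens_simps)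
  show "distr_tens B Y k ((a, label c), (x, free_map Y proj2 k c)) = ((a, x), c)"
    using free_map_incl_label[OF Y c(1)] by (simp add: distr_tens_def tens_map_def incl_def)
next
  fix z' assume "z' \<in> cells ((A \<times> B) \<cdot>\<^sub>c (X \<box> Y)) k" and e: "distr_tens B Y k z' = ((a, x), c)"
  then obtain a' b' x' c' where z': "z' = ((a', b'), (x', c'))" "b' \<in> B" "c' \<in> cells (free Y) k"
    by (auto simp: copower_simps tens_simps)
  then have "a' = a" "x' = x" "free_map (B \<cdot>\<^sub>c Y) (incl b') k c' = c"
    using e by (auto simp: distr_tens_def tens_map_def incl_def)
  then show "z' = ((a, label c), (x, free_map Y proj2 k c))"
    using z' free_map_proj2_incl[OF Y z'(2,3)] by simp
qed

lemma inv_distr_cprod: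
  assumes "((a, x), (b, y)) \<in> cells ((A \<cdot>\<^sub>c X) \<times>\<^sub>c (B \<cdot>\<^sub>c Y)) k"
  shows "inv_on ((A \<times> B) \<cdot>\<^sub>c (X \<times>\<^sub>c Y)) distr_cprod k ((a, x), (b, y)) = ((a, b), (x, y))"
  using assms
  by (intro inv_on_eq) (auto simp: distr_cprod_def cprod_map_def incl_def cprod_simps copower_simps)

section \<open>The globularization\<close>

abbreviation cop :: "'i set \<Rightarrow> ('i \<times> arity) coll" where
  "cop A \<equiv> A \<cdot>\<^sub>c terminal_coll"

lemma collection_cop: "collection (cop A)"
  by (rule collection_copower[OF collection_terminal])

lemmas globular_cop = collectionD(1)[OF collection_cop]

lemma ghom_globularization: "ghom (globularization P) n m = cop (Hom P n m)"
  and gident_globularization: "gident (globularization P) n = incl (Ident P n) \<odot> free_unit one_glob"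
  and gunit_globularization: "gunit (globularization P) = incl (Ident P 0)"
  by (simp_all add: globularization_def)

text \<open>After the inverse of the distributivity map, \<open>terminal_mult\<close> returns the
  arity of the cell with its labels removed. Forgetting labels does not affect arities, so this is
  the arity of the original cell.\<close>

lemma gcomp_globularization:
  assumes "w \<in> cells (cop (Hom P m l) \<box> cop (Hom P n m)) k"
  shows "gcomp (globularization P) n m l k w =
    (Comp P n m l (fst (fst w)) (label (snd w)), ar (cop (Hom P m l) \<box> cop (Hom P n m)) k w)"
proof -
  obtain g x c where w: "w = ((g, x), c)" by (cases w) auto
  have c: "c \<in> cells (free (cop (Hom P n m))) k" using assms w by (auto simp: tens_simps)
  note T = collectionD(1)[OF collection_terminal]
  have "globular_map terminal_coll (free one_glob) id_map"
    using collectionD(2)[OF collection_terminal] by (simp add: terminal_simps)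
  moreover have "(id_map :: nat \<Rightarrow> arity \<Rightarrow> arity) \<odot> proj2 = ar (cop (Hom P n m))"
    by (simp add: fun_eq_iff map_comp_glob_def id_map_def proj2_def copower_simps terminal_simps)
  ultimately have "free_map (free one_glob) id_map k (free_map terminal_coll proj2 k c) =
      free_map (free one_glob) (ar (cop (Hom P n m))) k c"
    using free_map_comp[OF globular_cop T copower_proj2_globular _ c] by metis
  then show ?thesis
    using inv_distr_tens[OF collection_terminal collection_terminal assms[unfolded w]] w
    by (simp add: globularization_def map_comp_glob_def copower_map_def terminal_mult_def
        tens_simps terminal_simps)
qed

lemma gplus_globularization:
  assumes "w \<in> cells (cop (Hom P n m) \<times>\<^sub>c cop (Hom P l r)) k"
  shows "gplus (globularization P) n m l r k w =
    (Sum P n m l r (fst (fst w)) (fst (snd w)), ar (cop (Hom P n m) \<times>\<^sub>c cop (Hom P l r)) k w)"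
proof -
  obtain f x g y where w: "w = ((f, x), (g, y))" by (cases w) auto
  show ?thesis
    using inv_distr_cprod[OF assms[unfolded w]] w
    by (simp add: globularization_def map_comp_glob_def copower_map_def proj1_def
        cprod_simps copower_simps terminal_simps id_map_def)
qed

section \<open>The axioms of a globular PRO, from the laws of the PRO\<close>

context
  fixes P :: "'p pro"
  assumes P: "PRO P"
begin

abbreviation (input) "Q \<equiv> globularization P"
abbreviation (input) "H n m \<equiv> cop (Hom P n m)"

lemma PRO_closed:
  "g \<in> Hom P m l \<Longrightarrow> f \<in> Hom P n m \<Longrightarrow> Comp P n m l g f \<in> Hom P n l"
  "Ident P n \<in> Hom P n n"
  "f \<in> Hom P n m \<Longrightarrow> f' \<in> Hom P l k \<Longrightarrow> Sum P n m l k f f' \<in> Hom P (n + l) (m + k)"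
  using P by (simp_all add: PRO_def)

lemma PRO_laws:
  "h \<in> Hom P l r \<Longrightarrow> g \<in> Hom P m l \<Longrightarrow> f \<in> Hom P n m \<Longrightarrow>
    Comp P n m r (Comp P m l r h g) f = Comp P n l r h (Comp P n m l g f)"
  "f \<in> Hom P n m \<Longrightarrow> Comp P n m m (Ident P m) f = f"
  "f \<in> Hom P n m \<Longrightarrow> Comp P n n m f (Ident P n) = f"
  "f \<in> Hom P n m \<Longrightarrow> f' \<in> Hom P m r \<Longrightarrow> g \<in> Hom P l k \<Longrightarrow> g' \<in> Hom P k s \<Longrightarrow>
    Comp P (n + l) (m + k) (r + s) (Sum P m r k s f' g') (Sum P n m l k f g) =
    Sum P n r l s (Comp P n m r f' f) (Comp P l k s g' g)"
  "Sum P n n m m (Ident P n) (Ident P m) = Ident P (n + m)"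
  "f \<in> Hom P n m \<Longrightarrow> g \<in> Hom P l k \<Longrightarrow> h \<in> Hom P r s \<Longrightarrow>
    Sum P (n + l) (m + k) r s (Sum P n m l k f g) h =
    Sum P n m (l + r) (k + s) f (Sum P l k r s g h)"
  "f \<in> Hom P n m \<Longrightarrow> Sum P 0 0 n m (Ident P 0) f = f"
  "f \<in> Hom P n m \<Longrightarrow> Sum P n m 0 0 f (Ident P 0) = f"
  using P by (simp_all add: PRO_def)

lemma coll_map_gcomp: "coll_map (H m l \<box> H n m) (H n l) (gcomp Q n m l)"
proof (rule coll_map_into_copower_terminal)
  show "collection (H m l \<box> H n m)" by (intro collection_tens collection_cop)
  show "gcomp Q n m l k w = (Comp P n m l (fst (fst w)) (label (snd w)), ar (H m l \<box> H n m) k w) \<and>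
      Comp P n m l (fst (fst w)) (label (snd w)) \<in> Hom P n l"
    if "w \<in> cells (H m l \<box> H n m) k" for k w
    using gcomp_globularization[OF that] that
    by (auto simp: tens_simps copower_simps intro!: PRO_closed(1) label_in)
  show "Comp P n m l (fst (fst (gsrc (H m l \<box> H n m) k w))) (label (snd (gsrc (H m l \<box> H n m) k w))) =
      Comp P n m l (fst (fst w)) (label (snd w)) \<and>
    Comp P n m l (fst (fst (gtgt (H m l \<box> H n m) k w))) (label (snd (gtgt (H m l \<box> H n m) k w))) =
      Comp P n m l (fst (fst w)) (label (snd w))"
    if "w \<in> cells (H m l \<box> H n m) (Suc k)" for k w
    using that by (auto simp: tens_simps copower_simps label_gsrc[OF globular_cop])
qed

lemma coll_map_gplus: "coll_map (H n m \<times>\<^sub>c H l k) (H (n + l) (m + k)) (gplus Q n m l k)"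
proof (rule coll_map_into_copower_terminal)
  show "collection (H n m \<times>\<^sub>c H l k)" by (intro collection_cprod collection_cop)
  show "gplus Q n m l k j w =
      (Sum P n m l k (fst (fst w)) (fst (snd w)), ar (H n m \<times>\<^sub>c H l k) j w) \<and>
      Sum P n m l k (fst (fst w)) (fst (snd w)) \<in> Hom P (n + l) (m + k)"
    if "w \<in> cells (H n m \<times>\<^sub>c H l k) j" for j w
    using gplus_globularization[OF that] that PRO_closed(3)
    by (auto simp: cprod_simps copower_simps)
qed (simp add: cprod_simps copower_simps)

lemma coll_map_free_unit_one: "coll_map unit_coll terminal_coll (free_unit one_glob)"
  using coll_map_ar[OF collection_unit] by (simp add: unit_coll_def)

lemma coll_map_gident: "coll_map unit_coll (H n n) (gident Q n)"
  unfolding gident_globularization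
  by (rule coll_map_comp[OF coll_map_free_unit_one coll_map_incl[OF PRO_closed(2)]])

lemma coll_map_gunit: "coll_map terminal_coll (H 0 0) (gunit Q)"
  unfolding gunit_globularization by (rule coll_map_incl[OF PRO_closed(2)])

lemma coll_map_unit_diag: "coll_map unit_coll (unit_coll \<times>\<^sub>c unit_coll) unit_diag"
  using coll_map_pair[OF coll_map_id coll_map_id, of unit_coll]
  by (simp add: unit_diag_def[abs_def] id_map_def)

lemma fst_gident: "fst (gident Q n k x) = Ident P n"
  by (simp add: gident_globularization map_comp_glob_def incl_def)

lemma fst_gunit: "fst (gunit Q k x) = Ident P 0"
  by (simp add: gunit_globularization incl_def)

lemma fst_gcomp:
  "w \<in> cells (H m l \<box> H n m) k \<Longrightarrow>
    fst (gcomp Q n m l k w) = Comp P n m l (fst (fst w)) (label (snd w))"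
  by (simp add: gcomp_globularization)

lemma fst_gplus:
  "w \<in> cells (H n m \<times>\<^sub>c H l r) k \<Longrightarrow>
    fst (gplus Q n m l r k w) = Sum P n m l r (fst (fst w)) (fst (snd w))"
  by (simp add: gplus_globularization)


lemma gcomp_assoc:
  "map_eq (H l r \<box> (H m l \<box> H n m))
    (gcomp Q n m r \<odot> tens_map (H n m) (gcomp Q m l r) id_map \<odot> tens_assoc (H m l) (H n m))
    (gcomp Q n l r \<odot> tens_map (H n l) id_map (gcomp Q n m l))"
proof (rule map_eq_into_copower_terminal)
  let ?W = "H l r \<box> (H m l \<box> H n m)" and ?L = "tens_map (H n m) (gcomp Q m l r) id_map"
    and ?R = "tens_map (H n l) id_map (gcomp Q n m l)" and ?a = "tens_assoc (H m l) (H n m)"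
  have M: "collection (H m l \<box> H n m)" by (intro collection_tens collection_cop)
  note GM = collectionD(1)[OF M]
  have A: "coll_map ?W ((H l r \<box> H m l) \<box> H n m) ?a"
    by (intro coll_map_tens_assoc collection_cop)
  have L: "coll_map ((H l r \<box> H m l) \<box> H n m) (H m r \<box> H n m) ?L"
    by (intro coll_map_tens_map collection_cop coll_map_gcomp coll_map_id)
  have R: "coll_map ?W (H l r \<box> H n l) ?R"
    by (intro coll_map_tens_map M collection_cop coll_map_gcomp coll_map_id)
  note LA = coll_map_comp[OF A L]
  show "coll_map ?W (H n r) (gcomp Q n m r \<odot> ?L \<odot> ?a)"
    by (rule coll_map_comp[OF LA coll_map_gcomp])
  show "coll_map ?W (H n r) (gcomp Q n l r \<odot> ?R)"
    by (rule coll_map_comp[OF R coll_map_gcomp])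
  fix k w assume w: "w \<in> cells ?W k"
  obtain h x c where whc: "w = ((h, x), c)" by (cases w) auto
  have h: "h \<in> Hom P l r" and c: "c \<in> cells (free (H m l \<box> H n m)) k"
    using w whc by (auto simp: tens_simps copower_simps)
  \<comment> \<open>The diagram \<open>c\<close> consists of cells of a tensor product. Its head is
    again a cell together with a diagram; their labels play the roles of the two inner morphisms in
    the associativity law of \<open>P\<close>.\<close>
  let ?d = "hd_cell c"
  have d: "?d \<in> cells (H m l \<box> H n m) (hd_dim k c)" by (rule hd_cell_in_cells[OF GM c])
  then have gf: "fst (fst ?d) \<in> Hom P m l" "label (snd ?d) \<in> Hom P n m"
    by (auto simp: tens_simps copower_simps intro: label_in)
  have "?a k w \<in> cells ((H l r \<box> H m l) \<box> H n m) k" by (rule coll_mapD(2)[OF A w])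
  then have a: "((h, x), free_map (H m l) proj1 k c) \<in> cells (H l r \<box> H m l) k"
    "free_mult (H n m) k (free_map (free (H n m)) proj2 k c) \<in> cells (free (H n m)) k"
    using whc by (auto simp: tens_assoc_def tens_simps(1)[of "H l r \<box> H m l"])
  have "fst ((gcomp Q n m r \<odot> ?L \<odot> ?a) k w) =
    Comp P n m r (fst (fst ((?L \<odot> ?a) k w))) (label (snd ((?L \<odot> ?a) k w)))"
    using fst_gcomp[OF coll_mapD(2)[OF LA w]] by (simp add: map_comp_glob_def)
  also have "\<dots> = Comp P n m r (Comp P m l r h (fst (fst ?d))) (label (snd ?d))"
    using whc fst_gcomp[OF a(1)] free_map_id[OF globular_cop a(2)]
      label_free_map[OF GM tens_proj_globular(1) c]
      label_free_mult_free_map[OF GM globular_cop tens_proj_globular(2) c]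
    by (simp add: map_comp_glob_def tens_assoc_def tens_map_def proj1_def proj2_def)
  also have "\<dots> = Comp P n l r h (Comp P n m l (fst (fst ?d)) (label (snd ?d)))"
    by (rule PRO_laws(1)[OF h gf])
  also have "\<dots> = Comp P n l r (fst (fst (?R k w))) (label (snd (?R k w)))"
    using whc fst_gcomp[OF d] label_free_map[OF GM coll_mapD(1)[OF coll_map_gcomp] c]
    by (simp add: tens_map_def id_map_def)
  also have "\<dots> = fst ((gcomp Q n l r \<odot> ?R) k w)"
    using fst_gcomp[OF coll_mapD(2)[OF R w]] by (simp add: map_comp_glob_def)
  finally show "fst ((gcomp Q n m r \<odot> ?L \<odot> ?a) k w) = fst ((gcomp Q n l r \<odot> ?R) k w)" .
qed

lemma gcomp_unit_left:
  "map_eq (H n m)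
    (gcomp Q n m m \<odot> tens_map (H n m) (gident Q m) id_map \<odot> tens_unit_left (H n m)) id_map"
proof (rule map_eq_into_copower_terminal)
  let ?L = "tens_map (H n m) (gident Q m) id_map" and ?a = "tens_unit_left (H n m)"
  have A: "coll_map (H n m) (unit_coll \<box> H n m) ?a"
    by (intro coll_map_tens_unit_left collection_cop)
  have L: "coll_map (unit_coll \<box> H n m) (H m m \<box> H n m) ?L"
    by (intro coll_map_tens_map collection_cop coll_map_gident coll_map_id)
  note LA = coll_map_comp[OF A L]
  show "coll_map (H n m) (H n m) (gcomp Q n m m \<odot> ?L \<odot> ?a)"
    by (rule coll_map_comp[OF LA coll_map_gcomp])
  show "coll_map (H n m) (H n m) id_map" by (rule coll_map_id)
  fix k w assume w: "w \<in> cells (H n m) k"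
  have u: "free_unit (H n m) k w \<in> cells (free (H n m)) k"
    by (rule globular_mapD(1)[OF free_unit_globular[OF globular_cop] w])
  have f: "fst w \<in> Hom P n m" using w by (auto simp: copower_simps)
  show "fst ((gcomp Q n m m \<odot> ?L \<odot> ?a) k w) = fst (id_map k w)"
    using fst_gcomp[OF coll_mapD(2)[OF LA w]] free_map_id[OF globular_cop u] label_free_unit[OF w]
      PRO_laws(2)[OF f]
    by (simp add: map_comp_glob_def tens_map_def tens_unit_left_def fst_gident id_map_def)
qed

text \<open>Whatever the shape of the diagram of unit cells, \<open>gident\<close> gives its head
  the label \<open>Ident P n\<close>, and hence the whole image.\<close>

lemma gcomp_unit_right:
  "map_eq (H n m \<box> unit_coll) (gcomp Q n n m \<odot> tens_map (H n n) id_map (gident Q n)) proj1"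
proof (rule map_eq_into_copower_terminal)
  let ?L = "tens_map (H n n) id_map (gident Q n)"
  have L: "coll_map (H n m \<box> unit_coll) (H n m \<box> H n n) ?L"
    by (intro coll_map_tens_map collection_cop collection_unit coll_map_gident coll_map_id)
  show "coll_map (H n m \<box> unit_coll) (H n m) (gcomp Q n n m \<odot> ?L)"
    by (rule coll_map_comp[OF L coll_map_gcomp])
  show "coll_map (H n m \<box> unit_coll) (H n m) proj1" by (rule coll_map_tens_unit_right)
  fix k w assume w: "w \<in> cells (H n m \<box> unit_coll) k"
  then have f: "fst (fst w) \<in> Hom P n m" and c: "snd w \<in> cells (free unit_coll) k"
    by (auto simp: tens_simps copower_simps)
  show "fst ((gcomp Q n n m \<odot> ?L) k w) = fst (proj1 k w)"
    using fst_gcomp[OF coll_mapD(2)[OF L w]] PRO_laws(3)[OF f]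
      label_free_map[OF collectionD(1)[OF collection_unit] coll_mapD(1)[OF coll_map_gident] c]
    by (simp add: map_comp_glob_def tens_map_def fst_gident id_map_def proj1_def)
qed

lemma globular_category_globularization: "globular_category Q"
  unfolding globular_category_def ghom_globularization
  using collection_cop coll_map_gcomp coll_map_gident gcomp_assoc gcomp_unit_left gcomp_unit_right
  by blast

lemma gplus_functorial:
  "map_eq ((H m r \<times>\<^sub>c H k s) \<box> (H n m \<times>\<^sub>c H l k))
    (gcomp Q (n + l) (m + k) (r + s)
      \<odot> tens_map (H (n + l) (m + k)) (gplus Q m r k s) (gplus Q n m l k))
    (gplus Q n r l s \<odot> cprod_map (gcomp Q n m r) (gcomp Q l k s)
      \<odot> tens_interchange (H n m) (H l k))"
proof (rule map_eq_into_copower_terminal)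
  let ?W = "(H m r \<times>\<^sub>c H k s) \<box> (H n m \<times>\<^sub>c H l k)"
    and ?L = "tens_map (H (n + l) (m + k)) (gplus Q m r k s) (gplus Q n m l k)"
    and ?R = "cprod_map (gcomp Q n m r) (gcomp Q l k s)" and ?i = "tens_interchange (H n m) (H l k)"
  have M: "collection (H n m \<times>\<^sub>c H l k)" by (intro collection_cprod collection_cop)
  note GM = collectionD(1)[OF M]
  have L: "coll_map ?W (H (m + k) (r + s) \<box> H (n + l) (m + k)) ?L"
    by (intro coll_map_tens_map M collection_cop coll_map_gplus)
  have I: "coll_map ?W ((H m r \<box> H n m) \<times>\<^sub>c (H k s \<box> H l k)) ?i"
    by (intro coll_map_tens_interchange collection_cop)
  have R: "coll_map ((H m r \<box> H n m) \<times>\<^sub>c (H k s \<box> H l k)) (H n r \<times>\<^sub>c H l s) ?R"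
    by (intro coll_map_cprod_map coll_map_gcomp)
  note RI = coll_map_comp[OF I R]
  show "coll_map ?W (H (n + l) (r + s)) (gcomp Q (n + l) (m + k) (r + s) \<odot> ?L)"
    by (rule coll_map_comp[OF L coll_map_gcomp])
  show "coll_map ?W (H (n + l) (r + s)) (gplus Q n r l s \<odot> ?R \<odot> ?i)"
    by (rule coll_map_comp[OF RI coll_map_gplus])
  fix j w assume w: "w \<in> cells ?W j"
  obtain a b c where wabc: "w = ((a, b), c)" by (cases w) auto
  have ab: "(a, b) \<in> cells (H m r \<times>\<^sub>c H k s) j" "fst a \<in> Hom P m r" "fst b \<in> Hom P k s"
    and c: "c \<in> cells (free (H n m \<times>\<^sub>c H l k)) j"
    using w wabc by (auto simp: tens_simps copower_simps cprod_simps)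
  \<comment> \<open>The head of the diagram is a pair of cells of equal arity. Both sides depend on
    \<open>c\<close> only through the two labels of this pair, and the interchange law of
    \<open>P\<close> compares them.\<close>
  let ?d = "hd_cell c"
  have d: "?d \<in> cells (H n m \<times>\<^sub>c H l k) (hd_dim j c)" by (rule hd_cell_in_cells[OF GM c])
  then have fg: "fst (fst ?d) \<in> Hom P n m" "fst (snd ?d) \<in> Hom P l k"
    by (auto simp: cprod_simps copower_simps)
  have "?i j w \<in> cells ((H m r \<box> H n m) \<times>\<^sub>c (H k s \<box> H l k)) j" by (rule coll_mapD(2)[OF I w])
  then have i: "(a, free_map (H n m) proj1 j c) \<in> cells (H m r \<box> H n m) j"
    "(b, free_map (H l k) proj2 j c) \<in> cells (H k s \<box> H l k) j"
    using wabc by (auto simp: tens_interchange_def cprod_simps)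
  have "fst ((gcomp Q (n + l) (m + k) (r + s) \<odot> ?L) j w) =
    Comp P (n + l) (m + k) (r + s) (Sum P m r k s (fst a) (fst b))
      (Sum P n m l k (fst (fst ?d)) (fst (snd ?d)))"
    using fst_gcomp[OF coll_mapD(2)[OF L w]] wabc fst_gplus[OF ab(1)] fst_gplus[OF d]
      label_free_map[OF GM coll_mapD(1)[OF coll_map_gplus] c]
    by (simp add: map_comp_glob_def tens_map_def)
  also have "\<dots> = Sum P n r l s (Comp P n m r (fst a) (fst (fst ?d)))
      (Comp P l k s (fst b) (fst (snd ?d)))"
    by (rule PRO_laws(4)[OF fg(1) ab(2) fg(2) ab(3)])
  also have "\<dots> = fst ((gplus Q n r l s \<odot> ?R \<odot> ?i) j w)"
    using fst_gplus[OF coll_mapD(2)[OF RI w]] wabc fst_gcomp[OF i(1)] fst_gcomp[OF i(2)]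
      label_free_map[OF GM coll_mapD(1)[OF coll_map_proj1] c]
      label_free_map[OF GM coll_mapD(1)[OF coll_map_proj2] c]
    by (simp add: map_comp_glob_def tens_interchange_def cprod_map_def proj1_def proj2_def)
  finally show "fst ((gcomp Q (n + l) (m + k) (r + s) \<odot> ?L) j w) =
    fst ((gplus Q n r l s \<odot> ?R \<odot> ?i) j w)" .
qed

lemma gplus_gident:
  "map_eq unit_coll (gplus Q n n m m \<odot> cprod_map (gident Q n) (gident Q m) \<odot> unit_diag)
    (gident Q (n + m))"
proof (rule map_eq_into_copower_terminal)
  let ?R = "cprod_map (gident Q n) (gident Q m)"
  have R: "coll_map (unit_coll \<times>\<^sub>c unit_coll) (H n n \<times>\<^sub>c H m m) ?R"
    by (intro coll_map_cprod_map coll_map_gident)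
  note RI = coll_map_comp[OF coll_map_unit_diag R]
  show "coll_map unit_coll (H (n + m) (n + m)) (gplus Q n n m m \<odot> ?R \<odot> unit_diag)"
    by (rule coll_map_comp[OF RI coll_map_gplus])
  show "coll_map unit_coll (H (n + m) (n + m)) (gident Q (n + m))" by (rule coll_map_gident)
  show "fst ((gplus Q n n m m \<odot> ?R \<odot> unit_diag) k w) = fst (gident Q (n + m) k w)"
    if w: "w \<in> cells unit_coll k" for k w
    using fst_gplus[OF coll_mapD(2)[OF RI w]] PRO_laws(5)
    by (simp add: map_comp_glob_def cprod_map_def unit_diag_def fst_gident)
qed

lemma gplus_assoc:
  "map_eq ((H n m \<times>\<^sub>c H l k) \<times>\<^sub>c H r s)
    (gplus Q (n + l) (m + k) r s \<odot> cprod_map (gplus Q n m l k) id_map)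
    (gplus Q n m (l + r) (k + s) \<odot> cprod_map id_map (gplus Q l k r s) \<odot> cprod_assoc)"
proof (rule map_eq_into_copower_terminal)
  let ?W = "(H n m \<times>\<^sub>c H l k) \<times>\<^sub>c H r s" and ?L = "cprod_map (gplus Q n m l k) id_map"
    and ?R = "cprod_map id_map (gplus Q l k r s)"
  have L: "coll_map ?W (H (n + l) (m + k) \<times>\<^sub>c H r s) ?L"
    by (intro coll_map_cprod_map coll_map_gplus coll_map_id)
  have R: "coll_map (H n m \<times>\<^sub>c (H l k \<times>\<^sub>c H r s)) (H n m \<times>\<^sub>c H (l + r) (k + s)) ?R"
    by (intro coll_map_cprod_map coll_map_gplus coll_map_id)
  note RA = coll_map_comp[OF coll_map_cprod_assoc R]
  show "coll_map ?W (H (n + l + r) (m + k + s)) (gplus Q (n + l) (m + k) r s \<odot> ?L)"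
    by (rule coll_map_comp[OF L coll_map_gplus])
  \<comment> \<open>The two bracketings of the sum have the same hom-collection as codomain only
    after reassociating the indices, which \<open>add.assoc\<close> does.\<close>
  show "coll_map ?W (H (n + l + r) (m + k + s)) (gplus Q n m (l + r) (k + s) \<odot> ?R \<odot> cprod_assoc)"
    using coll_map_comp[OF RA coll_map_gplus] by (simp add: add.assoc)
  fix j w assume w: "w \<in> cells ?W j"
  obtain a b c where wabc: "w = ((a, b), c)" by (cases w) auto
  have abc: "(a, b) \<in> cells (H n m \<times>\<^sub>c H l k) j" "(b, c) \<in> cells (H l k \<times>\<^sub>c H r s) j"
    "fst a \<in> Hom P n m" "fst b \<in> Hom P l k" "fst c \<in> Hom P r s"
    using w wabc by (auto simp: cprod_simps copower_simps)
  show "fst ((gplus Q (n + l) (m + k) r s \<odot> ?L) j w) =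
    fst ((gplus Q n m (l + r) (k + s) \<odot> ?R \<odot> cprod_assoc) j w)"
    using fst_gplus[OF coll_mapD(2)[OF L w]] fst_gplus[OF coll_mapD(2)[OF RA w]] wabc
      fst_gplus[OF abc(1)] fst_gplus[OF abc(2)] PRO_laws(6)[OF abc(3-5)]
    by (simp add: map_comp_glob_def cprod_map_def cprod_assoc_def id_map_def)
qed

lemma globular_sum_globularization: "globular_sum Q"
  unfolding globular_sum_def ghom_globularization
  using coll_map_gplus gplus_functorial gplus_gident gplus_assoc
  by blast

text \<open>All labels are \<open>Ident P 0\<close>, so the claim on labels is that this identity
  composed with itself is itself.\<close>

lemma gunit_terminal_mult:
  "map_eq (terminal_coll \<box> terminal_coll)
    (gcomp Q 0 0 0 \<odot> tens_map (H 0 0) (gunit Q) (gunit Q)) (gunit Q \<odot> terminal_mult)"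
proof (rule map_eq_into_copower_terminal)
  let ?W = "terminal_coll \<box> terminal_coll" and ?L = "tens_map (H 0 0) (gunit Q) (gunit Q)"
  have L: "coll_map ?W (H 0 0 \<box> H 0 0) ?L"
    by (intro coll_map_tens_map collection_terminal collection_cop coll_map_gunit)
  show "coll_map ?W (H 0 0) (gcomp Q 0 0 0 \<odot> ?L)"
    by (rule coll_map_comp[OF L coll_map_gcomp])
  have "coll_map ?W terminal_coll terminal_mult"
    unfolding terminal_mult_def by (intro coll_map_ar collection_tens collection_terminal)
  then show "coll_map ?W (H 0 0) (gunit Q \<odot> terminal_mult)"
    by (rule coll_map_comp[OF _ coll_map_gunit])
  fix k w assume w: "w \<in> cells ?W k"
  then have c: "snd w \<in> cells (free terminal_coll) k" by (auto simp: tens_simps)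
  show "fst ((gcomp Q 0 0 0 \<odot> ?L) k w) = fst ((gunit Q \<odot> terminal_mult) k w)"
    using fst_gcomp[OF coll_mapD(2)[OF L w]] PRO_laws(2)[OF PRO_closed(2)]
      label_free_map[OF collectionD(1)[OF collection_terminal] coll_mapD(1)[OF coll_map_gunit] c]
    by (simp add: map_comp_glob_def tens_map_def fst_gunit)
qed

lemma gplus_unit_left:
  "map_eq (terminal_coll \<times>\<^sub>c H n m) (gplus Q 0 0 n m \<odot> cprod_map (gunit Q) id_map) proj2"
proof (rule map_eq_into_copower_terminal)
  let ?L = "cprod_map (gunit Q) id_map"
  have L: "coll_map (terminal_coll \<times>\<^sub>c H n m) (H 0 0 \<times>\<^sub>c H n m) ?L"
    by (intro coll_map_cprod_map coll_map_gunit coll_map_id)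
  \<comment> \<open>Strict unitality needs the index \<open>0 + n\<close> to be \<open>n\<close>;
    the simplifier makes this identification.\<close>
  show "coll_map (terminal_coll \<times>\<^sub>c H n m) (H n m) (gplus Q 0 0 n m \<odot> ?L)"
    using coll_map_comp[OF L coll_map_gplus] by simp
  show "coll_map (terminal_coll \<times>\<^sub>c H n m) (H n m) proj2" by (rule coll_map_proj2)
  fix k w assume w: "w \<in> cells (terminal_coll \<times>\<^sub>c H n m) k"
  then have f: "fst (snd w) \<in> Hom P n m" by (auto simp: cprod_simps copower_simps)
  show "fst ((gplus Q 0 0 n m \<odot> ?L) k w) = fst (proj2 k w)"
    using fst_gplus[OF coll_mapD(2)[OF L w]] PRO_laws(7)[OF f]
    by (simp add: map_comp_glob_def cprod_map_def fst_gunit id_map_def proj2_def)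
qed

lemma gplus_unit_right:
  "map_eq (H n m \<times>\<^sub>c terminal_coll) (gplus Q n m 0 0 \<odot> cprod_map id_map (gunit Q)) proj1"
proof (rule map_eq_into_copower_terminal)
  let ?L = "cprod_map id_map (gunit Q)"
  have L: "coll_map (H n m \<times>\<^sub>c terminal_coll) (H n m \<times>\<^sub>c H 0 0) ?L"
    by (intro coll_map_cprod_map coll_map_gunit coll_map_id)
  show "coll_map (H n m \<times>\<^sub>c terminal_coll) (H n m) (gplus Q n m 0 0 \<odot> ?L)"
    using coll_map_comp[OF L coll_map_gplus] by simp
  show "coll_map (H n m \<times>\<^sub>c terminal_coll) (H n m) proj1" by (rule coll_map_proj1)
  fix k w assume w: "w \<in> cells (H n m \<times>\<^sub>c terminal_coll) k"
  then have f: "fst (fst w) \<in> Hom P n m" by (auto simp: cprod_simps copower_simps)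
  show "fst ((gplus Q n m 0 0 \<odot> ?L) k w) = fst (proj1 k w)"
    using fst_gplus[OF coll_mapD(2)[OF L w]] PRO_laws(8)[OF f]
    by (simp add: map_comp_glob_def cprod_map_def fst_gunit id_map_def proj1_def)
qed

lemma globular_unit_globularization: "globular_unit Q"
proof -
  \<comment> \<open>By the definition of the globularization, \<open>gident\<close> at object 0 is
    literally this composite.\<close>
  have "map_eq unit_coll (gunit Q \<odot> free_unit one_glob) (gident Q 0)"
    by (simp add: map_eq_def gunit_globularization gident_globularization)
  then show ?thesis
    unfolding globular_unit_def ghom_globularization
    using coll_map_gunit gunit_terminal_mult gplus_unit_left gplus_unit_right by blast
qed

end

theorem theorem13p1:
  fixes P :: "'p pro"
  assumes "PRO P"
  shows "globular_PRO (globularization P)"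
  unfolding globular_PRO_def
  using assms globular_category_globularization globular_sum_globularization
    globular_unit_globularization by blast

end
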